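(* There is a universal constant $M<\infty$ such that for all $t>0$ and all $0<c\le t/\mathbb{E}Z(t)_+$, $$\mathbb{P}\{Z(t)>c\,\mathbb{E}Z(t)_+\}\le M\,\frac{t^2}{(\mathbb{E}Z(t)_+)^3}\Big(\frac1{c^3}+\frac1{c^4}\Big).$$
   Context: Stationary Hammersley process with parameter $1$: independent Poisson processes of $\alpha$-points (intensity 1 in $(0,\infty)^2$), sources (intensity 1 on $(0,\infty)\times\{0\}$) and sinks (intensity 1 on $\{0\}\times(0,\infty)$). For $-t\le z\le t$ let $N(z)$ be the number of sources in $(0,z]\times\{0\}$ if $z\ge0$ and the number of sinks in $\{0\}\times(0,|z|]$ if $z<0$; let $A_t(z)$ be the maximal length $k$ of a chain of $\alpha$-points $(x_1,t_1),\dots,(x_k,t_k)$ with $x_1<\dots<x_k$, $t_1<\dots<t_k$ lying in $(z,t]\times(0,t]$ if $z\ge0$, or in $(0,t]\times(|z|,t]$ if $z<0$. Let $L(t,t)=\sup_{-t\le z\le t}\{N(z)+A_t(z)\}$ (the length of a longest weakly North–East path from $(0,0)$ to $(t,t)$) and let the exit point be $Z(t)=\sup\{z\in[-t,t]: N(z)+A_t(z)=L(t,t)\}$. *)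

theory Defs
  imports "HOL-Probability.Probability"
begin

definition poisson_count :: "'a measure \<Rightarrow> ('a \<Rightarrow> nat) \<Rightarrow> real \<Rightarrow> bool" where
  "poisson_count P X r \<longleftrightarrow>
     X \<in> measurable P (count_space UNIV) \<and>
     (\<forall>k. measure P {\<omega> \<in> space P. X \<omega> = k} = r ^ k / fact k * exp (- r))"

text \<open>alpha: alpha-points (Poisson, intensity 1 on (0,oo)^2);
  src: x-coordinates of the sources on (0,oo) x {0} (Poisson, intensity 1);
  snk: y-coordinates of the sinks on {0} x (0,oo) (Poisson, intensity 1);
  the three processes are independent.  Characterised by: for disjoint bounded
  Borel sets the counts are jointly independent Poisson variables with mean the
  Lebesgue measure, plus almost sure local finiteness.\<close>

definition hammersley_model ::
  "'a measure \<Rightarrow> ('a \<Rightarrow> (real \<times> real) set) \<Rightarrow> ('a \<Rightarrow> real set) \<Rightarrow> ('a \<Rightarrow> real set) \<Rightarrow> bool" where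
  "hammersley_model P alpha src snk \<longleftrightarrow>
     prob_space P \<and>
     (AE \<omega> in P. (\<forall>B :: (real \<times> real) set. bounded B \<longrightarrow> finite (alpha \<omega> \<inter> B)) \<and>
        (\<forall>B :: real set. bounded B \<longrightarrow> finite (src \<omega> \<inter> B) \<and> finite (snk \<omega> \<inter> B))) \<and>
     (\<forall>(A :: nat \<Rightarrow> (real \<times> real) set) (S :: nat \<Rightarrow> real set) (K :: nat \<Rightarrow> real set) (n :: nat).
        (\<forall>i<n. A i \<in> sets borel \<and> bounded (A i) \<and> A i \<subseteq> {0<..} \<times> {0<..}) \<and>
        (\<forall>i<n. S i \<in> sets borel \<and> bounded (S i) \<and> S i \<subseteq> {0<..}) \<and>
        (\<forall>i<n. K i \<in> sets borel \<and> bounded (K i) \<and> K i \<subseteq> {0<..}) \<and>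
        disjoint_family_on A {..<n} \<and> disjoint_family_on S {..<n} \<and> disjoint_family_on K {..<n}
        \<longrightarrow>
        (let cnt = (\<lambda>j \<omega>. case j of
                         Inl i \<Rightarrow> card (alpha \<omega> \<inter> A i)
                       | Inr (Inl i) \<Rightarrow> card (src \<omega> \<inter> S i)
                       | Inr (Inr i) \<Rightarrow> card (snk \<omega> \<inter> K i));
             rate = (\<lambda>j. case j of
                         Inl i \<Rightarrow> measure lborel (A i)
                       | Inr (Inl i) \<Rightarrow> measure lborel (S i)
                       | Inr (Inr i) \<Rightarrow> measure lborel (K i));
             J = ({..<n} <+> ({..<n} <+> {..<n}))
         in prob_space.indep_vars P (\<lambda>_. count_space UNIV) cnt J \<and>
            (\<forall>j\<in>J. poisson_count P (cnt j) (rate j))))"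

definition hN :: "real set \<Rightarrow> real set \<Rightarrow> real \<Rightarrow> nat" where
  "hN src snk z = (if 0 \<le> z then card (src \<inter> {0<..z}) else card (snk \<inter> {0<..-z}))"

definition hrect :: "real \<Rightarrow> real \<Rightarrow> (real \<times> real) set" where
  "hrect t z = (if 0 \<le> z then {z<..t} \<times> {0<..t} else {0<..t} \<times> {-z<..t})"

definition is_chain :: "(real \<times> real) set \<Rightarrow> (real \<times> real) list \<Rightarrow> bool" where
  "is_chain Q xs \<longleftrightarrow> set xs \<subseteq> Q \<and> sorted_wrt (\<lambda>p q. fst p < fst q \<and> snd p < snd q) xs"

definition hA :: "(real \<times> real) set \<Rightarrow> real \<Rightarrow> real \<Rightarrow> nat" where
  "hA alpha t z = Sup {length xs | xs. is_chain (alpha \<inter> hrect t z) xs}"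

definition hL :: "(real \<times> real) set \<Rightarrow> real set \<Rightarrow> real set \<Rightarrow> real \<Rightarrow> nat" where
  "hL alpha src snk t = Sup {hN src snk z + hA alpha t z | z. -t \<le> z \<and> z \<le> t}"

definition hZ :: "(real \<times> real) set \<Rightarrow> real set \<Rightarrow> real set \<Rightarrow> real \<Rightarrow> real" where
  "hZ alpha src snk t =
     Sup {z. -t \<le> z \<and> z \<le> t \<and> hN src snk z + hA alpha t z = hL alpha src snk t}"

end

theory Submission
  imports Defs "HOL-Real_Asymp.Real_Asymp"
begin

text \<open>
  The Poisson model is approximated by a lattice model with independent Bernoulli sources, sinks and
  bulk points whose odds satisfy \<open>odds source * odds sink = P(bulk point)\<close>. This model is exactly
  stationary: the increments of the last-passage time along any down-right path are independent
  Bernoulli variables. Writing \<open>L\<close> as entering plus leaving points gives its mean, and gives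
  \<open>Var L = Var N - Var W + 2 Cov(L, W)\<close>, where \<open>W\<close> counts the sinks and \<open>N\<close> the points
  leaving at the top; the covariance with the sources is at most a constant times \<open>E Z\<^sub>+\<close>, because adding a
  source increases \<open>L\<close> only below the exit point.

  For the tail, multiply the source odds by \<open>l = 1 + u / (2 t)\<close>, divide the sink odds by \<open>l\<close>, and keep the
  bulk points. If \<open>Z > u\<close>, then the sources added on \<open>(0, u]\<close>, about \<open>(l - 1) u\<close> in mean, are at
  most \<open>L\<^sub>l - L\<close>, which has mean about \<open>t (l - 1)\<^sup>2 / l\<close>; Chebyshev's inequality bounds this event.
  The variance of \<open>L\<^sub>l\<close> is controlled through the sinks, whose influence only decreases with \<open>l\<close>.

  On a locally finite configuration the lattice quantities agree with the continuous ones once the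
  mesh is fine, so the bound passes to the limit.
\<close>

section \<open>Last-passage percolation with sources and sinks on the lattice\<close>

text \<open>Chebyshev is applied with a gap of order u^2 / t and a variance of order u + E Z_+,
  which yields t^2 (1 / u^3 + E Z_+ / u^4); for u = c E Z_+ these are the two terms of the claim.
  The tilt \<open>l - 1 = u / (2 t)\<close> maximises (l - 1) u - t (l - 1)^2.

  The obstacle is the variance of L_l. Treating it like that of L would bring in the exit point of
  the tilted model, which the extra sources and missing sinks push to the right. The influence of a
  sink moves the other way, so it can be compared with the untilted model.

  On the lattice all laws have finite support, so integrability is automatic and covariances reduce
  to flipping one site. The price is an exact relation between the three occupation probabilities,
  which cells of one common side a violate: the boundary odds are exp a - 1, while a bulk square is
  occupied with probability 1 - exp (- a^2) instead of (exp a - 1)^2. Hence boundary and bulk get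
  different meshes, and the comparison with the continuum has to absorb the drift between
  them.\<close>

datatype site = Src nat | Snk nat | Bulk nat nat

primrec tally :: "(nat \<Rightarrow> bool) \<Rightarrow> nat \<Rightarrow> nat" where
  "tally h 0 = 0"
| "tally h (Suc m) = tally h m + of_bool (h m)"

lemma tally_eq_sum: "tally h m = (\<Sum>k<m. of_bool (h k))"
  by (induction m) auto

lemma tally_eq_card: "tally h m = card {k. k < m \<and> h k}"
  by (simp add: tally_eq_sum Int_def)

lemma tally_mono: "m \<le> m' \<Longrightarrow> tally h m \<le> tally h m'"
  by (induction m' rule: dec_induct) auto

lemma tally_mono_pred: "(\<And>k. h k \<Longrightarrow> h' k) \<Longrightarrow> tally h m \<le> tally h' m"
  by (induction m) (auto intro!: add_mono)

text \<open>The count on the window from m to m' grows with the predicate; the additive form avoids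
  truncated subtraction.\<close>

lemma tally_diff_mono:
  "m \<le> m' \<Longrightarrow> (\<And>k. h k \<Longrightarrow> h' k) \<Longrightarrow> tally h' m + tally h m' \<le> tally h' m' + tally h m"
proof (induction m' rule: dec_induct)
  case (step k)
  have "of_bool (h k) \<le> (of_bool (h' k) :: nat)" using step(4) by auto
  then show ?case using step by (simp del: of_bool_less_eq_iff)
qed simp

lemma tally_upd:
  "tally (h(i := True)) m = tally (h(i := False)) m + of_bool (i < m)"
  by (induction m) (auto simp: less_Suc_eq)

text \<open>A bulk point is collected only on a diagonal step, so two points of one row or column
  are never combined: the lattice form of strict chains.\<close>

fun lpp :: "(site \<Rightarrow> bool) \<Rightarrow> nat \<Rightarrow> nat \<Rightarrow> nat" where
  "lpp f 0 j = tally (\<lambda>k. f (Snk k)) j"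
| "lpp f (Suc i) 0 = tally (\<lambda>k. f (Src k)) (Suc i)"
| "lpp f (Suc i) (Suc j) =
     max (max (lpp f i (Suc j)) (lpp f (Suc i) j)) (lpp f i j + of_bool (f (Bulk i j)))"

lemma lpp_0_right: "lpp f i 0 = tally (\<lambda>k. f (Src k)) i"
  by (cases i) auto

text \<open>Both increments share one induction, because each new increment at a cell needs both
  increments at its lower left corner.\<close>

lemma lpp_increments:
  "lpp f (Suc i) j \<in> {lpp f i j, Suc (lpp f i j)}" "lpp f i (Suc j) \<in> {lpp f i j, Suc (lpp f i j)}"
proof -
  have "lpp f (Suc i) j \<in> {lpp f i j, Suc (lpp f i j)} \<and> lpp f i (Suc j) \<in> {lpp f i j, Suc (lpp f i j)}"
  proof (induction "i + j" arbitrary: i j rule: less_induct)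
    case less
    have A: "lpp f (Suc i) j \<in> {lpp f i j, Suc (lpp f i j)}"
    proof (cases j)
      case 0
      then show ?thesis by (simp add: lpp_0_right)
    next
      case (Suc j')
      then show ?thesis using less[of i j'] by (auto simp: max_def)
    qed
    have B: "lpp f i (Suc j) \<in> {lpp f i j, Suc (lpp f i j)}"
    proof (cases i)
      case 0
      then show ?thesis by simp
    next
      case (Suc i')
      then show ?thesis using less[of i' j] by (auto simp: max_def)
    qed
    show ?case using A B by blast
  qed
  then show "lpp f (Suc i) j \<in> {lpp f i j, Suc (lpp f i j)}" "lpp f i (Suc j) \<in> {lpp f i j, Suc (lpp f i j)}"
    by blast+
qed

lemma lpp_upd_Bulk:
  "\<not> (k < i \<and> l < j) \<Longrightarrow> lpp (f(Bulk k l := y)) i j = lpp f i j"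
  by (induction f i j rule: lpp.induct) auto

section \<open>Variational formula: boundary points up to the exit position plus a longest bulk
  chain\<close>

definition boundary_count :: "(site \<Rightarrow> bool) \<Rightarrow> int \<Rightarrow> nat" where
  "boundary_count f z = (if 0 \<le> z then tally (\<lambda>k. f (Src k)) (nat z) else tally (\<lambda>k. f (Snk k)) (nat (- z)))"

text \<open>Since \<open>nat\<close> truncates, at most one of the two lower bounds is positive, so
  both signs of z share one formula.\<close>

definition cells :: "(site \<Rightarrow> bool) \<Rightarrow> int \<Rightarrow> nat \<Rightarrow> nat \<Rightarrow> (nat \<times> nat) set" where
  "cells f z i j = {(k, l). nat z \<le> k \<and> k < i \<and> nat (- z) \<le> l \<and> l < j \<and> f (Bulk k l)}"

abbreviation incr_list :: "('a::linorder \<times> 'b::linorder) list \<Rightarrow> bool" where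
  "incr_list \<equiv> sorted_wrt (\<lambda>p q. fst p < fst q \<and> snd p < snd q)"

definition bulk_length :: "(site \<Rightarrow> bool) \<Rightarrow> nat \<Rightarrow> int \<Rightarrow> nat" where
  "bulk_length f n z = Sup {length xs | xs. set xs \<subseteq> cells f z n n \<and> incr_list xs}"

lemma incr_list_distinct: "incr_list xs \<Longrightarrow> distinct xs"
  by (induction xs) auto

lemma incr_list_length_le_card:
  assumes "finite Q" "set xs \<subseteq> Q" "incr_list xs"
  shows "length xs \<le> card Q"
  using card_mono[OF assms(1,2)] distinct_card[OF incr_list_distinct[OF assms(3)]] by simp

text \<open>Finiteness of Q makes the \<open>Sup\<close> on \<open>nat\<close> a genuine maximum.
  The general order types serve lattice cells here and \<alpha>-points in the plane later.\<close>

lemma incr_list_Sup: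
  fixes Q :: "('a::linorder \<times> 'b::linorder) set"
  assumes "finite Q"
  shows "\<And>xs. set xs \<subseteq> Q \<Longrightarrow> incr_list xs \<Longrightarrow>
           length xs \<le> Sup {length xs | xs. set xs \<subseteq> Q \<and> incr_list xs}"
    and "\<exists>xs. set xs \<subseteq> Q \<and> incr_list xs \<and>
           length xs = Sup {length xs | xs. set xs \<subseteq> Q \<and> incr_list xs}"
proof -
  let ?S = "{length xs | xs. set xs \<subseteq> Q \<and> incr_list xs}"
  have "?S \<subseteq> {..card Q}" using incr_list_length_le_card[OF assms] by auto
  then have fin: "finite ?S" using finite_subset by blast
  have ne: "?S \<noteq> {}" by (rule ex_in_conv[THEN iffD1], rule exI[of _ 0]) (auto intro!: exI[of _ "[]"])
  have Sup: "Sup ?S = Max ?S" using fin ne by (simp add: cSup_eq_Max)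
  show "length xs \<le> Sup ?S" if "set xs \<subseteq> Q" "incr_list xs" for xs
    unfolding Sup using fin that by (intro Max_ge) auto
  show "\<exists>xs. set xs \<subseteq> Q \<and> incr_list xs \<and> length xs = Sup ?S"
    using Max_in[OF fin ne] unfolding Sup by (smt (verit) mem_Collect_eq)
qed

lemma finite_cells: "finite (cells f z i j)"
  by (rule finite_subset[of _ "{..<i} \<times> {..<j}"]) (auto simp: cells_def)

lemma bulk_length_upper: "set xs \<subseteq> cells f z n n \<Longrightarrow> incr_list xs \<Longrightarrow> length xs \<le> bulk_length f n z"
  unfolding bulk_length_def by (rule incr_list_Sup(1)[OF finite_cells])

lemma bulk_length_attained: "\<exists>xs. set xs \<subseteq> cells f z n n \<and> incr_list xs \<and> length xs = bulk_length f n z"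
  unfolding bulk_length_def by (rule incr_list_Sup(2)[OF finite_cells])

text \<open>The last cell of the chain selects the branch of the recursion: unless it is the corner
  cell, the whole path already fits into a rectangle with one row or one column less.\<close>

lemma lpp_ge_path:
  assumes "- int j \<le> z" "z \<le> int i" "set xs \<subseteq> cells f z i j" "incr_list xs"
  shows "boundary_count f z + length xs \<le> lpp f i j"
  using assms
proof (induction f i j arbitrary: z xs rule: lpp.induct)
  case (1 f j)
  then have "xs = []" by (auto simp: cells_def)
  moreover have "boundary_count f z \<le> tally (\<lambda>k. f (Snk k)) j"
    using 1 unfolding boundary_count_def by (cases "z = 0") (auto intro!: tally_mono)
  ultimately show ?case by simp
next
  case (2 f i)
  then have "xs = []" by (auto simp: cells_def)
  moreover have "boundary_count f z \<le> tally (\<lambda>k. f (Src k)) (Suc i)"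
    using 2 unfolding boundary_count_def by (auto intro!: tally_mono simp del: tally.simps)
  ultimately show ?case by simp
next
  case (3 f i j)
  show ?case
  proof (cases xs rule: rev_cases)
    \<comment> \<open>With no cells left, only z has to stay admissible: for z =
      \<open>Suc i\<close> a row is removed, otherwise a column.\<close>
    case Nil
    show ?thesis
    proof (cases "z = int (Suc i)")
      case True
      then show ?thesis using "3.IH"(2)[of z "[]"] Nil by simp
    next
      case False
      then show ?thesis using "3.IH"(1)[of z "[]"] 3(4,5) Nil by simp
    qed
  next
    case (snoc ys e)
    obtain k l where e: "e = (k, l)" by (cases e)
    have mem: "(k, l) \<in> cells f z (Suc i) (Suc j)" using 3(6) snoc e by auto
    have inc: "incr_list ys" and below: "\<And>p. p \<in> set ys \<Longrightarrow> fst p < k \<and> snd p < l"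
      using 3(7) snoc e by (auto simp: sorted_wrt_append)
    have ys: "set ys \<subseteq> cells f z k l" using 3(6) below snoc by (force simp: cells_def)
    consider "k < i" | "l < j" | "k = i" "l = j" using mem by (force simp: cells_def)
    then show ?thesis
    proof cases
      case 1
      have "set xs \<subseteq> cells f z i (Suc j)" using 1 ys mem snoc e by (force simp: cells_def)
      then have "boundary_count f z + length xs \<le> lpp f i (Suc j)"
        using 1 mem 3(4,5,7) by (intro "3.IH") (auto simp: cells_def)
      then show ?thesis by simp
    next
      case 2
      have "set xs \<subseteq> cells f z (Suc i) j" using 2 ys mem snoc e by (force simp: cells_def)
      then have "boundary_count f z + length xs \<le> lpp f (Suc i) j"
        using 2 mem 3(4,5,7) by (intro "3.IH") (auto simp: cells_def)
      then show ?thesis by simp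
    next
      case 3
      have "boundary_count f z + length ys \<le> lpp f i j"
        using 3 ys mem inc by (intro "3.IH") (auto simp: cells_def)
      moreover have "f (Bulk i j)" using 3 mem by (auto simp: cells_def)
      ultimately show ?thesis using snoc by simp
    qed
  qed
qed

text \<open>Backtracking through the recursion; a cell is appended only where the diagonal step with
  a bulk point realises the maximum.\<close>

lemma lpp_path_attained:
  "\<exists>z xs. - int j \<le> z \<and> z \<le> int i \<and> set xs \<subseteq> cells f z i j \<and> incr_list xs \<and>
     boundary_count f z + length xs = lpp f i j"
proof (induction f i j rule: lpp.induct)
  case (1 f j)
  show ?case by (rule exI[of _ "- int j"], rule exI[of _ "[]"]) (auto simp: boundary_count_def)
next
  case (2 f i)
  show ?case by (rule exI[of _ "int (Suc i)"], rule exI[of _ "[]"]) (auto simp: boundary_count_def nat_add_distrib)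
next
  case (3 f i j)
  have mono: "cells f z i' j' \<subseteq> cells f z (Suc i) (Suc j)" if "i' \<le> Suc i" "j' \<le> Suc j" for z i' j'
    using that by (auto simp: cells_def)
  have lift: "\<exists>z xs. - int (Suc j) \<le> z \<and> z \<le> int (Suc i) \<and> set xs \<subseteq> cells f z (Suc i) (Suc j) \<and>
        incr_list xs \<and> boundary_count f z + length xs = v"
    if le: "i' \<le> Suc i" "j' \<le> Suc j" and ex: "\<exists>z xs. - int j' \<le> z \<and> z \<le> int i' \<and>
        set xs \<subseteq> cells f z i' j' \<and> incr_list xs \<and> boundary_count f z + length xs = v" for i' j' v
  proof -
    obtain z xs where "- int j' \<le> z" "z \<le> int i'" "set xs \<subseteq> cells f z i' j'" "incr_list xs"
      "boundary_count f z + length xs = v" using ex by blast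
    then show ?thesis using le mono[OF le, of z] by (intro exI[of _ z] exI[of _ xs]) auto
  qed
  consider "lpp f (Suc i) (Suc j) = lpp f i (Suc j)" | "lpp f (Suc i) (Suc j) = lpp f (Suc i) j"
    | "lpp f (Suc i) (Suc j) = lpp f i j"
    | "f (Bulk i j)" "lpp f (Suc i) (Suc j) = Suc (lpp f i j)"
  proof -
    have "lpp f (Suc i) (Suc j) = lpp f i (Suc j) \<or> lpp f (Suc i) (Suc j) = lpp f (Suc i) j \<or>
      lpp f (Suc i) (Suc j) = lpp f i j \<or> f (Bulk i j) \<and> lpp f (Suc i) (Suc j) = Suc (lpp f i j)"
      by (auto simp: max_def)
    then show thesis using that by blast
  qed
  then show ?case
  proof cases
    case 1
    show ?thesis unfolding 1 by (rule lift[OF _ _ 3(1)]) auto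
  next
    case 2
    show ?thesis unfolding 2 by (rule lift[OF _ _ 3(2)]) auto
  next
    case 3
    show ?thesis unfolding 3 by (rule lift[OF _ _ "3.IH"(3)]) auto
  next
    case 4
    obtain z xs where z: "- int j \<le> z" "z \<le> int i" "set xs \<subseteq> cells f z i j" "incr_list xs"
      "boundary_count f z + length xs = lpp f i j" using 3(3) by blast
    have "set (xs @ [(i, j)]) \<subseteq> cells f z (Suc i) (Suc j)"
      using z 4 mono[of i j z] by (auto simp: cells_def)
    moreover have "incr_list (xs @ [(i, j)])"
      using z by (auto simp: sorted_wrt_append cells_def)
    ultimately show ?thesis using z 4
      by (intro exI[of _ z] exI[of _ "xs @ [(i, j)]"]) auto
  qed
qed

lemma lpp_ge:
  assumes "\<bar>z\<bar> \<le> int n"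
  shows "boundary_count f z + bulk_length f n z \<le> lpp f n n"
proof -
  obtain xs where "set xs \<subseteq> cells f z n n" "incr_list xs" "length xs = bulk_length f n z"
    using bulk_length_attained by blast
  then show ?thesis using lpp_ge_path[of n z n xs f] assms by auto
qed

lemma lpp_attained: "\<exists>z. \<bar>z\<bar> \<le> int n \<and> boundary_count f z + bulk_length f n z = lpp f n n"
proof -
  obtain z xs where z: "- int n \<le> z" "z \<le> int n" "set xs \<subseteq> cells f z n n" "incr_list xs"
      "boundary_count f z + length xs = lpp f n n" using lpp_path_attained[of n n f] by blast
  then show ?thesis using bulk_length_upper[of xs f z n] lpp_ge[of z n f]
    by (intro exI[of _ z]) linarith
qed

section \<open>Exit index and the influence of single boundary points\<close>

definition exit_index :: "(site \<Rightarrow> bool) \<Rightarrow> nat \<Rightarrow> nat" where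
  "exit_index f n = Max (insert 0 {k. k \<le> n \<and> boundary_count f (int k) + bulk_length f n (int k) = lpp f n n})"

lemma exit_index_ge: "k \<le> n \<Longrightarrow> boundary_count f (int k) + bulk_length f n (int k) = lpp f n n \<Longrightarrow> k \<le> exit_index f n"
  unfolding exit_index_def by (intro Max_ge) auto

lemma exit_index_le: "exit_index f n \<le> n"
  unfolding exit_index_def by (subst Max_le_iff) auto

text \<open>Positivity rules out the inserted default 0, which stands for the case that no maximiser
  is positive. So \<open>exit_index\<close> is the lattice form of the positive part of the exit
  point.\<close>

lemma exit_index_maximizer:
  assumes "0 < exit_index f n"
  shows "boundary_count f (int (exit_index f n)) + bulk_length f n (int (exit_index f n)) = lpp f n n"
proof -
  have "exit_index f n \<in> insert 0 {k. k \<le> n \<and> boundary_count f (int k) + bulk_length f n (int k) = lpp f n n}"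
    unfolding exit_index_def by (intro Max_in) auto
  then show ?thesis using assms by auto
qed

lemma bulk_length_cong: "(\<And>k l. f (Bulk k l) = g (Bulk k l)) \<Longrightarrow> bulk_length f n z = bulk_length g n z"
  by (simp add: bulk_length_def cells_def)

text \<open>Take a maximiser z of the configuration with the source. It profits from the source only
  if z > i, and the maximum rises only if z was already optimal without it; then z is at most the
  exit index of the configuration without it.\<close>

lemma lpp_Src_upd:
  assumes "i < n"
  shows "lpp (f(Src i := True)) n n \<le> lpp (f(Src i := False)) n n +
           of_bool (i < exit_index (f(Src i := False)) n)"
proof -
  let ?f1 = "f(Src i := True)" and ?f0 = "f(Src i := False)"
  obtain z where z: "\<bar>z\<bar> \<le> int n" "boundary_count ?f1 z + bulk_length ?f1 n z = lpp ?f1 n n"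
    using lpp_attained by blast
  have A: "bulk_length ?f1 n z = bulk_length ?f0 n z" by (rule bulk_length_cong) auto
  have le: "boundary_count ?f0 z + bulk_length ?f0 n z \<le> lpp ?f0 n n" using lpp_ge z by blast
  have upd: "(\<lambda>k. (f(Src i := y)) (Src k)) = (\<lambda>k. f (Src k))(i := y)"
    "(\<lambda>k. (f(Src i := y)) (Snk k)) = (\<lambda>k. f (Snk k))" for y by auto
  have N: "boundary_count ?f1 z = boundary_count ?f0 z + of_bool (int i < z)"
    unfolding boundary_count_def upd using tally_upd[of "\<lambda>k. f (Src k)" i "nat z"]
    by (auto simp: zless_nat_conj simp del: fun_upd_apply)
  show ?thesis
  proof (cases "int i < z \<and> boundary_count ?f0 z + bulk_length ?f0 n z = lpp ?f0 n n")
    case True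
    then have "nat z \<le> exit_index ?f0 n" using z by (intro exit_index_ge) auto
    then have "i < exit_index ?f0 n" using True by linarith
    then show ?thesis using True z N A by simp
  next
    case False
    then show ?thesis using z N A le by (cases "int i < z") (auto simp del: fun_upd_apply)
  qed
qed

lemma lpp_mono:
  assumes "\<And>x. f x \<Longrightarrow> g x"
  shows "lpp f i j \<le> lpp g i j"
  using assms
proof (induction f i j rule: lpp.induct)
  case (3 f i j)
  have "of_bool (f (Bulk i j)) \<le> (of_bool (g (Bulk i j)) :: nat)" using 3(4) by auto
  then show ?case unfolding lpp.simps by (intro max.mono add_mono 3)
next
  case (2 f i)
  then show ?case unfolding lpp.simps by (intro tally_mono_pred)
qed (use assms in \<open>auto intro!: tally_mono_pred add_mono\<close>)

text \<open>The gain from an additional sink is at most one, and it is one iff some maximiser uses that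
  sink; more sources or fewer sinks can only destroy this.\<close>

lemma lpp_Snk_upd_antimono:
  assumes j: "j < n" and bulk: "\<And>k l. f (Bulk k l) = g (Bulk k l)"
    and src: "\<And>k. f (Src k) \<Longrightarrow> g (Src k)" and snk: "\<And>k. g (Snk k) \<Longrightarrow> f (Snk k)"
  shows "int (lpp (g(Snk j := True)) n n) - int (lpp (g(Snk j := False)) n n)
    \<le> int (lpp (f(Snk j := True)) n n) - int (lpp (f(Snk j := False)) n n)"
proof -
  have upd: "(\<lambda>k. (h(Snk j := y)) (Snk k)) = (\<lambda>k. h (Snk k))(j := y)"
    "(\<lambda>k. (h(Snk j := y)) (Src k)) = (\<lambda>k. h (Src k))" for h y by auto
  have N: "boundary_count (h(Snk j := True)) z = boundary_count (h(Snk j := False)) z + of_bool (z < - int j)" for h z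
    unfolding boundary_count_def upd using tally_upd[of "\<lambda>k. h (Snk k)" j "nat (- z)"]
    by (auto simp: zless_nat_conj simp del: fun_upd_apply)
  have A: "bulk_length (h(Snk j := y)) n z = bulk_length h n z" for h y z by (rule bulk_length_cong) auto
  have Agf: "bulk_length g n z = bulk_length f n z" for z by (rule bulk_length_cong) (simp add: bulk)
  let ?g0 = "g(Snk j := False)" and ?f0 = "f(Snk j := False)"
  let ?g1 = "g(Snk j := True)" and ?f1 = "f(Snk j := True)"
  obtain z1 where z1: "\<bar>z1\<bar> \<le> int n" "boundary_count ?g1 z1 + bulk_length ?g1 n z1 = lpp ?g1 n n"
    using lpp_attained by blast
  obtain z2 where z2: "\<bar>z2\<bar> \<le> int n" "boundary_count ?f0 z2 + bulk_length ?f0 n z2 = lpp ?f0 n n"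
    using lpp_attained by blast
  have mf: "lpp ?f0 n n \<le> lpp ?f1 n n" by (rule lpp_mono) (auto split: if_splits)
  have g0: "boundary_count ?g0 z + bulk_length g n z \<le> lpp ?g0 n n" if "\<bar>z\<bar> \<le> int n" for z
    using lpp_ge[OF that, of ?g0] A by simp
  have f1: "boundary_count ?f1 z + bulk_length f n z \<le> lpp ?f1 n n" if "\<bar>z\<bar> \<le> int n" for z
    using lpp_ge[OF that, of ?f1] A by simp
  show ?thesis
  proof (cases "lpp ?g1 n n \<le> lpp ?g0 n n")
    case True
    then show ?thesis using mf by linarith
  next
    case False
    have less: "z1 < - int j" and gain: "lpp ?g1 n n = Suc (boundary_count ?g0 z1 + bulk_length g n z1)"
      using False z1 N[of g z1] A[of g True z1] g0[OF z1(1)]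
      by (auto simp: of_bool_def simp del: fun_upd_apply split: if_splits)
    have eq: "lpp ?g0 n n = boundary_count ?g0 z1 + bulk_length g n z1" using gain g0[OF z1(1)] False by linarith
    have "lpp ?f0 n n < lpp ?f1 n n"
    proof (cases "z2 < - int j")
      case True
      then show ?thesis using z2 N[of f z2] A[of f False z2] f1[OF z2(1)] by auto
    next
      case False
      \<comment> \<open>\<open>z1\<close> is optimal for \<open>?g0\<close> as well, and
        \<open>z1 < - j <= z2\<close>. Passing from \<open>?g0\<close> to \<open>?f0\<close> favours
        \<open>z1\<close>, which lies further into the sinks, over \<open>z2\<close>; hence
        \<open>z1\<close> is optimal for \<open>?f0\<close> too, and it uses the sink j.\<close>
      have "boundary_count ?f0 z2 + boundary_count ?g0 z1 \<le> boundary_count ?f0 z1 + boundary_count ?g0 z2"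
      proof (cases "z2 \<ge> 0")
        case True
        have "boundary_count ?f0 z2 \<le> boundary_count ?g0 z2" using True src by (auto simp: boundary_count_def intro!: tally_mono_pred)
        moreover have "boundary_count ?g0 z1 \<le> boundary_count ?f0 z1" using less snk by (auto simp: boundary_count_def intro!: tally_mono_pred)
        ultimately show ?thesis by linarith
      next
        case neg: False
        define a b where "a = nat (- z2)" and "b = nat (- z1)"
        have ab: "a \<le> b" using less False unfolding a_def b_def by linarith
        have "tally (\<lambda>k. ?f0 (Snk k)) a + tally (\<lambda>k. ?g0 (Snk k)) b
            \<le> tally (\<lambda>k. ?f0 (Snk k)) b + tally (\<lambda>k. ?g0 (Snk k)) a"
          using snk by (intro tally_diff_mono[OF ab]) auto
        then show ?thesis using neg less unfolding boundary_count_def a_def[symmetric] b_def[symmetric]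
          by (simp del: fun_upd_apply)
      qed
      then have "boundary_count ?f0 z2 + bulk_length f n z2 \<le> boundary_count ?f0 z1 + bulk_length f n z1"
        using eq g0[OF z2(1)] Agf by (simp del: fun_upd_apply)
      then show ?thesis using z2(2) A[of f False z2] f1[OF z1(1)] N[of f z1] less
        by (simp del: fun_upd_apply)
    qed
    moreover have "lpp ?g1 n n \<le> Suc (lpp ?g0 n n)" using gain eq by simp
    ultimately show ?thesis by linarith
  qed
qed

section \<open>Stationarity and moments\<close>

definition sites :: "nat \<Rightarrow> site set" where
  "sites n = Src ` {..<n} \<union> Snk ` {..<n} \<union> (\<lambda>(i, j). Bulk i j) ` ({..<n} \<times> {..<n})"

definition bsites :: "nat \<Rightarrow> site set" where
  "bsites n = Src ` {..<n} \<union> Snk ` {..<n}"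

fun rate :: "real \<Rightarrow> real \<Rightarrow> real \<Rightarrow> site \<Rightarrow> real" where
  "rate p q r (Src k) = p"
| "rate p q r (Snk k) = q"
| "rate p q r (Bulk k l) = r"

definition law :: "nat \<Rightarrow> real \<Rightarrow> real \<Rightarrow> real \<Rightarrow> (site \<Rightarrow> bool) pmf" where
  "law n p q r = Pi_pmf (sites n) False (\<lambda>x. bernoulli_pmf (rate p q r x))"

lemma finite_sites [simp]: "finite (sites n)" "finite (bsites n)"
  by (auto simp: sites_def bsites_def)

lemma mem_sites [simp]:
  "Src k \<in> sites n \<longleftrightarrow> k < n" "Snk k \<in> sites n \<longleftrightarrow> k < n" "Bulk k l \<in> sites n \<longleftrightarrow> k < n \<and> l < n"
  "Src k \<in> bsites n \<longleftrightarrow> k < n" "Snk k \<in> bsites n \<longleftrightarrow> k < n" "Bulk k l \<notin> bsites n"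
  by (auto simp: sites_def bsites_def)

text \<open>Independence as it is used below: the coordinate c may be drawn afresh for any statistic
  that ignores it. The form with \<open>bind_pmf\<close> fits both the corner updates and the
  resampling of one site.\<close>

lemma Pi_pmf_independent_coordinate:
  assumes "finite A" "c \<in> A" and indep: "\<And>f y. X (f(c := y)) = X f"
  shows "map_pmf (\<lambda>f. g (f c) (X f)) (Pi_pmf A d p) =
    bind_pmf (p c) (\<lambda>y. map_pmf (g y) (map_pmf X (Pi_pmf A d p)))"
proof -
  define A' where "A' = A - {c}"
  have A: "A = insert c A'" "finite A'" "c \<notin> A'" using assms by (auto simp: A'_def)
  have X: "map_pmf X (Pi_pmf A d p) = map_pmf X (Pi_pmf A' d p)"
    unfolding A(1) Pi_pmf_insert'[OF A(2,3)] map_bind_pmf map_return_pmf indep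
    by (simp add: map_pmf_def)
  show ?thesis unfolding X unfolding A(1) Pi_pmf_insert'[OF A(2,3)] map_bind_pmf map_return_pmf
    by (simp add: indep map_pmf_def bind_assoc_pmf bind_return_pmf)
qed

text \<open>The local Hammersley rule at one cell: h and v are the \<open>lpp\<close> increments
  along its bottom and left sides, the result those along its top and right sides. Two increments
  annihilate, a bulk point w creates a pair where there is none, and a single one passes
  through.\<close>

fun corner :: "bool \<Rightarrow> bool \<times> bool \<Rightarrow> bool \<times> bool" where
  "corner w (h, v) = (if h = v then (\<not> h \<and> w, \<not> h \<and> w) else (h, v))"

text \<open>The hypothesis is a balance: annihilation of a pair has probability p q, creation r (1 -
  p) (1 - q), and the mixed outcomes are left alone. In terms of odds, the source odds times the
  sink odds equal r.\<close>

lemma corner_stationary: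
  assumes "0 \<le> p" "p \<le> 1" "0 \<le> q" "q \<le> 1" "0 \<le> r" "r \<le> 1" and eq: "r * (1 - p) * (1 - q) = p * q"
  shows "bind_pmf (bernoulli_pmf r) (\<lambda>w. map_pmf (corner w) (pair_pmf (bernoulli_pmf p) (bernoulli_pmf q)))
    = pair_pmf (bernoulli_pmf p) (bernoulli_pmf q)"
proof (rule pmf_eqI)
  fix x :: "bool \<times> bool"
  obtain h v where x: "x = (h, v)" by (cases x)
  show "pmf (bind_pmf (bernoulli_pmf r) (\<lambda>w. map_pmf (corner w) (pair_pmf (bernoulli_pmf p) (bernoulli_pmf q)))) x
    = pmf (pair_pmf (bernoulli_pmf p) (bernoulli_pmf q)) x"
    unfolding x map_pmf_def pair_pmf_def bind_assoc_pmf bind_return_pmf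
    using assms eq by (cases h; cases v) (auto simp: pmf_bind algebra_simps)
qed

definition corner_upd :: "bool \<Rightarrow> 'a \<Rightarrow> 'a \<Rightarrow> ('a \<Rightarrow> bool) \<Rightarrow> 'a \<Rightarrow> bool" where
  "corner_upd w a b X = (let (h, v) = corner w (X a, X b) in X(b := v, a := h))"

text \<open>Only the coordinates a and b move, so the product splits into this pair, where
  \<open>corner_stationary\<close> applies, and an untouched rest.\<close>

lemma corner_upd_stationary:
  assumes pqr: "0 \<le> p" "p \<le> 1" "0 \<le> q" "q \<le> 1" "0 \<le> r" "r \<le> 1" "r * (1 - p) * (1 - q) = p * q"
    and C: "finite C" "a \<in> C" "b \<in> C" "a \<noteq> b"
    and P: "P a = bernoulli_pmf p" "P b = bernoulli_pmf q"
  shows "bind_pmf (bernoulli_pmf r) (\<lambda>w. map_pmf (corner_upd w a b) (Pi_pmf C d P)) = Pi_pmf C d P"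
proof -
  define C' where "C' = C - {a, b}"
  have C': "C = insert a (insert b C')" "finite C'" "a \<notin> insert b C'" "b \<notin> C'" "finite (insert b C')"
    using C by (auto simp: C'_def)
  define F where "F = (\<lambda>((h, v), f). f(b := v, a := h) :: 'a \<Rightarrow> bool)"
  let ?Q = "Pi_pmf C' d P"
  let ?pq = "pair_pmf (bernoulli_pmf p) (bernoulli_pmf q)"
  have Pi: "Pi_pmf C d P = map_pmf F (pair_pmf ?pq ?Q)"
    unfolding C'(1) Pi_pmf_insert'[OF C'(5,3)] Pi_pmf_insert'[OF C'(2,4)] P F_def
    by (simp add: pair_pmf_def map_bind_pmf bind_assoc_pmf bind_return_pmf)
  have upd: "corner_upd w a b (F (hv, f)) = F (corner w hv, f)" for w hv f
    using C(4) by (cases hv) (auto simp: corner_upd_def F_def Let_def fun_upd_twist)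
  have "map_pmf (corner_upd w a b) (Pi_pmf C d P) = map_pmf F (pair_pmf (map_pmf (corner w) ?pq) ?Q)" for w
    unfolding Pi pair_map_pmf1 pmf.map_comp
  proof (intro map_pmf_cong refl)
    fix x show "(corner_upd w a b \<circ> F) x = (F \<circ> apfst (corner w)) x"
      by (cases x) (simp only: o_apply upd apfst_conv)
  qed
  then have "bind_pmf (bernoulli_pmf r) (\<lambda>w. map_pmf (corner_upd w a b) (Pi_pmf C d P))
    = map_pmf F (pair_pmf (bind_pmf (bernoulli_pmf r) (\<lambda>w. map_pmf (corner w) ?pq)) ?Q)"
    by (simp add: map_bind_pmf pair_pmf_def bind_assoc_pmf)
  also have "\<dots> = Pi_pmf C d P" unfolding corner_stationary[OF pqr] Pi ..
  finally show ?thesis .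
qed

text \<open>The increments of \<^const>\<open>lpp\<close> along the down-right path which separates the columns below
  \<open>i\<close> and the lowest \<open>j\<close> cells of column \<open>i\<close> from the remaining cells.\<close>

fun frontier :: "nat \<Rightarrow> nat \<Rightarrow> nat \<Rightarrow> (site \<Rightarrow> bool) \<Rightarrow> site \<Rightarrow> bool" where
  "frontier n i j f (Src k) = (let h = if k < i then n else if k = i then j else 0
     in k < n \<and> lpp f (Suc k) h \<noteq> lpp f k h)"
| "frontier n i j f (Snk k) = (let c = if k < j then Suc i else i
     in k < n \<and> lpp f c (Suc k) \<noteq> lpp f c k)"
| "frontier n i j f (Bulk k l) = False"

lemma frontier_start: "frontier n 0 0 f = (\<lambda>x. if x \<in> bsites n then f x else False)"
proof
  fix x show "frontier n 0 0 f x = (if x \<in> bsites n then f x else False)"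
    by (cases x) (auto simp: lpp_0_right)
qed

lemma frontier_next_column: "frontier n i n f = frontier n (Suc i) 0 f"
proof
  fix x show "frontier n i n f x = frontier n (Suc i) 0 f x"
    by (cases x) (auto simp: Let_def less_Suc_eq)
qed

text \<open>The cell (i, j) still lies beyond the path; this is what makes its bulk point
  independent of the current increments.\<close>

lemma frontier_upd_Bulk: "frontier n i j (f(Bulk i j := y)) = frontier n i j f"
proof
  fix x show "frontier n i j (f(Bulk i j := y)) x = frontier n i j f x"
    by (cases x) (auto simp: Let_def lpp_upd_Bulk simp del: lpp.simps)
qed

text \<open>Absorbing the cell (i, j) pushes one corner of the path outwards, which affects only the
  increments across column i and row j.\<close>

lemma frontier_Suc:
  assumes "i < n" "j < n"
  shows "frontier n i (Suc j) f = corner_upd (f (Bulk i j)) (Src i) (Snk j) (frontier n i j f)"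
proof -
  define L where "L = lpp f i j"
  have I: "lpp f (Suc i) j = L \<or> lpp f (Suc i) j = Suc L" "lpp f i (Suc j) = L \<or> lpp f i (Suc j) = Suc L"
    using lpp_increments[of f i j] by (auto simp: L_def)
  have c: "corner (f (Bulk i j)) (lpp f (Suc i) j \<noteq> lpp f i j, lpp f i (Suc j) \<noteq> lpp f i j) =
     (lpp f (Suc i) (Suc j) \<noteq> lpp f i (Suc j), lpp f (Suc i) (Suc j) \<noteq> lpp f (Suc i) j)"
    unfolding lpp.simps L_def[symmetric] using I
    by (cases "f (Bulk i j)"; elim disjE) simp_all
  show ?thesis
  proof
    fix x
    have "frontier n i (Suc j) f x = ((frontier n i j f)(Snk j := lpp f (Suc i) (Suc j) \<noteq> lpp f (Suc i) j,
        Src i := lpp f (Suc i) (Suc j) \<noteq> lpp f i (Suc j))) x"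
      using assms by (cases x) (auto simp: Let_def less_Suc_eq simp del: lpp.simps)
    then show "frontier n i (Suc j) f x = corner_upd (f (Bulk i j)) (Src i) (Snk j) (frontier n i j f) x"
      unfolding corner_upd_def using c assms by (auto simp: Let_def simp del: lpp.simps corner.simps)
  qed
qed

context
  fixes n :: nat and p q r :: real
  assumes pqr: "0 \<le> p" "p \<le> 1" "0 \<le> q" "q \<le> 1" "0 \<le> r" "r \<le> 1" "r * (1 - p) * (1 - q) = p * q"
begin

text \<open>The path sweeps the square column by column, starting from the two axes. Each absorbed
  cell brings a fresh bulk point, so the law is preserved at every step; at i = n, j = 0 the path
  consists of the top and right sides.\<close>

lemma law_frontier:
  assumes "i < n \<and> j \<le> n \<or> i = n \<and> j = 0"
  shows "map_pmf (frontier n i j) (law n p q r) =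
    Pi_pmf (bsites n) False (\<lambda>x. bernoulli_pmf (rate p q r x))" (is "_ = ?R")
proof -
  have row: "map_pmf (frontier n i j) (law n p q r) = ?R"
    if "map_pmf (frontier n i 0) (law n p q r) = ?R" "i < n" "j \<le> n" for i j
    using that(3)
  proof (induction j)
    case (Suc j)
    have "map_pmf (frontier n i (Suc j)) (law n p q r) =
      map_pmf (\<lambda>f. corner_upd (f (Bulk i j)) (Src i) (Snk j) (frontier n i j f)) (law n p q r)"
      using Suc that by (intro map_pmf_cong refl frontier_Suc) auto
    also have "\<dots> = bind_pmf (bernoulli_pmf r) (\<lambda>w. map_pmf (corner_upd w (Src i) (Snk j))
        (map_pmf (frontier n i j) (law n p q r)))"
      unfolding law_def using Suc.prems that
        Pi_pmf_independent_coordinate[of "sites n" "Bulk i j" "frontier n i j"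
          "\<lambda>w. corner_upd w (Src i) (Snk j)" False "\<lambda>x. bernoulli_pmf (rate p q r x)"]
      by (simp add: frontier_upd_Bulk)
    also have "\<dots> = ?R"
      using Suc that pqr by (subst Suc.IH, simp) (rule corner_upd_stationary, auto)
    finally show ?case .
  qed (use that in simp)
  have col: "map_pmf (frontier n i 0) (law n p q r) = ?R" if "i \<le> n" for i
    using that
  proof (induction i)
    case 0
    have "frontier n 0 0 = (\<lambda>f x. if x \<in> bsites n then f x else False)"
      by (rule ext, rule frontier_start)
    then show ?case unfolding law_def
      using Pi_pmf_subset[of "sites n" "bsites n" False "\<lambda>x. bernoulli_pmf (rate p q r x)"]
      by (auto simp: bsites_def sites_def)
  next
    case (Suc i)
    have "frontier n (Suc i) 0 = frontier n i n" by (rule ext) (simp only: frontier_next_column)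
    then show ?case using row[of i n] Suc by simp
  qed
  show ?thesis using assms row[OF col] col by (metis le_refl less_imp_le)
qed

end

section \<open>Covariances and variances by flipping single coordinates\<close>

lemma integrable_Pi_pmf_finite [simp]:
  fixes P :: "'a \<Rightarrow> 'b::finite pmf" and g :: "('a \<Rightarrow> 'b) \<Rightarrow> real"
  assumes "finite A"
  shows "integrable (measure_pmf (Pi_pmf A d P)) g"
proof (rule integrable_measure_pmf_finite)
  show "finite (set_pmf (Pi_pmf A d P))"
    using assms by (auto simp: set_Pi_pmf intro!: finite_PiE_dflt)
qed

context
  fixes A :: "'a set" and P :: "'a \<Rightarrow> bool pmf" and \<mu> :: "('a \<Rightarrow> bool) pmf"
  assumes A: "finite A" and \<mu>: "\<mu> = Pi_pmf A False P"
begin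

lemma integrable_\<mu> [simp]: "integrable (measure_pmf \<mu>) (g :: _ \<Rightarrow> real)"
  using A by (simp add: \<mu>)

lemma variance_\<mu>:
  "measure_pmf.variance \<mu> (g :: _ \<Rightarrow> real) =
     measure_pmf.expectation \<mu> (\<lambda>f. (g f)\<^sup>2) - (measure_pmf.expectation \<mu> g)\<^sup>2"
  by (rule measure_pmf.variance_eq) simp_all

lemma expectation_resample:
  fixes G :: "('a \<Rightarrow> bool) \<Rightarrow> real"
  assumes c: "c \<in> A" "P c = bernoulli_pmf \<rho>" and \<rho>: "0 \<le> \<rho>" "\<rho> \<le> 1"
  shows "measure_pmf.expectation \<mu> G = \<rho> * measure_pmf.expectation \<mu> (\<lambda>f. G (f(c := True)))
    + (1 - \<rho>) * measure_pmf.expectation \<mu> (\<lambda>f. G (f(c := False)))"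
proof -
  have "map_pmf (\<lambda>f. (f(c := False))(c := f c)) \<mu> =
    bind_pmf (P c) (\<lambda>y. map_pmf (\<lambda>f. f(c := y)) (map_pmf (\<lambda>f. f(c := False)) \<mu>))"
    unfolding \<mu> by (rule Pi_pmf_independent_coordinate[OF A c(1), where X = "\<lambda>f. f(c := False)"]) simp
  then have "\<mu> = bind_pmf (bernoulli_pmf \<rho>) (\<lambda>y. map_pmf (\<lambda>f. f(c := y)) \<mu>)"
    by (simp add: c(2) map_pmf_comp)
  then have "measure_pmf.expectation \<mu> G =
      measure_pmf.expectation (bind_pmf (bernoulli_pmf \<rho>) (\<lambda>y. map_pmf (\<lambda>f. f(c := y)) \<mu>)) G"
    by simp
  also have "\<dots> = (\<Sum>y\<in>UNIV. pmf (bernoulli_pmf \<rho>) y *\<^sub>R measure_pmf.expectation (map_pmf (\<lambda>f. f(c := y)) \<mu>) G)"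
    using A by (intro pmf_expectation_bind) (auto simp: \<mu> set_Pi_pmf intro!: finite_PiE_dflt)
  also have "\<dots> = \<rho> * measure_pmf.expectation \<mu> (\<lambda>f. G (f(c := True)))
    + (1 - \<rho>) * measure_pmf.expectation \<mu> (\<lambda>f. G (f(c := False)))"
    using \<rho> by (simp add: UNIV_bool)
  finally show ?thesis .
qed

context
  fixes \<sigma> :: "nat \<Rightarrow> 'a" and m :: nat and \<rho> :: real
  assumes \<sigma>: "inj \<sigma>" "\<And>k. k < m \<Longrightarrow> \<sigma> k \<in> A" "\<And>k. k < m \<Longrightarrow> P (\<sigma> k) = bernoulli_pmf \<rho>"
    and \<rho>: "0 \<le> \<rho>" "\<rho> \<le> 1"
begin

text \<open>A Bernoulli integration by parts: the covariance of G with one coordinate is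
  \<open>\<rho> * (1 - \<rho>)\<close> times the mean effect on G of switching that coordinate
  on.\<close>

lemma expectation_tally_mult:
  fixes G :: "('a \<Rightarrow> bool) \<Rightarrow> real"
  shows "measure_pmf.expectation \<mu> (\<lambda>f. G f * tally (\<lambda>k. f (\<sigma> k)) m) = m * \<rho> * measure_pmf.expectation \<mu> G
    + \<rho> * (1 - \<rho>) * (\<Sum>k<m. measure_pmf.expectation \<mu> (\<lambda>f. G (f(\<sigma> k := True)))
        - measure_pmf.expectation \<mu> (\<lambda>f. G (f(\<sigma> k := False))))"
proof -
  have one: "measure_pmf.expectation \<mu> (\<lambda>f. G f * of_bool (f (\<sigma> k))) = \<rho> * measure_pmf.expectation \<mu> G
    + \<rho> * (1 - \<rho>) * (measure_pmf.expectation \<mu> (\<lambda>f. G (f(\<sigma> k := True)))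
        - measure_pmf.expectation \<mu> (\<lambda>f. G (f(\<sigma> k := False))))" if "k < m" for k
    using expectation_resample[OF \<sigma>(2,3) \<rho>, OF that that, of "\<lambda>f. G f * of_bool (f (\<sigma> k))"]
    by (subst expectation_resample[OF \<sigma>(2,3) \<rho>, OF that that, of G]) (simp add: algebra_simps)
  have "measure_pmf.expectation \<mu> (\<lambda>f. G f * tally (\<lambda>k. f (\<sigma> k)) m) =
    measure_pmf.expectation \<mu> (\<lambda>f. \<Sum>k<m. G f * of_bool (f (\<sigma> k)))"
    by (simp only: tally_eq_sum of_nat_sum of_nat_of_bool sum_distrib_left)
  also have "\<dots> = (\<Sum>k<m. measure_pmf.expectation \<mu> (\<lambda>f. G f * of_bool (f (\<sigma> k))))"
    by (intro Bochner_Integration.integral_sum) simp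
  also have "\<dots> = (\<Sum>k<m. \<rho> * measure_pmf.expectation \<mu> G
    + \<rho> * (1 - \<rho>) * (measure_pmf.expectation \<mu> (\<lambda>f. G (f(\<sigma> k := True)))
        - measure_pmf.expectation \<mu> (\<lambda>f. G (f(\<sigma> k := False)))))"
    by (intro sum.cong refl one) simp
  finally show ?thesis by (simp add: sum.distrib sum_distrib_left)
qed

lemma expectation_tally: "measure_pmf.expectation \<mu> (\<lambda>f. tally (\<lambda>k. f (\<sigma> k)) m) = m * \<rho>"
  using expectation_tally_mult[of "\<lambda>_. 1"] by simp

lemma variance_tally:
  "measure_pmf.variance \<mu> (\<lambda>f. tally (\<lambda>k. f (\<sigma> k)) m) = m * (\<rho> * (1 - \<rho>))"
proof -
  let ?T = "\<lambda>f. real (tally (\<lambda>k. f (\<sigma> k)) m)"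
  have upd: "(\<lambda>k. (f(\<sigma> i := y)) (\<sigma> k)) = (\<lambda>k. f (\<sigma> k))(i := y)" for f i y
    using \<sigma>(1) by (auto simp: fun_eq_iff inj_eq)
  have "measure_pmf.expectation \<mu> (\<lambda>f. ?T (f(\<sigma> k := True)))
        - measure_pmf.expectation \<mu> (\<lambda>f. ?T (f(\<sigma> k := False))) = 1" if "k < m" for k
    unfolding upd tally_upd[of _ k m] using that by simp
  then have "measure_pmf.expectation \<mu> (\<lambda>f. ?T f * ?T f) = m * \<rho> * (m * \<rho>) + \<rho> * (1 - \<rho>) * m"
    unfolding expectation_tally_mult[of ?T] expectation_tally by simp
  then show ?thesis unfolding variance_\<mu> by (simp add: expectation_tally power2_eq_square)
qed

text \<open>With T the tally, Var (G - T) = Var G + Var T - 2 Cov (G, T), solved for Var G. In the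
  application G is the last-passage time, and stationarity supplies the variance of H.\<close>

lemma variance_via_tally:
  fixes G :: "('a \<Rightarrow> bool) \<Rightarrow> real"
  defines "H \<equiv> \<lambda>f. G f - tally (\<lambda>k. f (\<sigma> k)) m"
  shows "measure_pmf.variance \<mu> G = measure_pmf.variance \<mu> H - m * (\<rho> * (1 - \<rho>))
    + 2 * (\<rho> * (1 - \<rho>)) * (\<Sum>k<m. measure_pmf.expectation \<mu> (\<lambda>f. G (f(\<sigma> k := True)))
        - measure_pmf.expectation \<mu> (\<lambda>f. G (f(\<sigma> k := False))))"
proof -
  let ?T = "\<lambda>f. real (tally (\<lambda>k. f (\<sigma> k)) m)"
  have H: "measure_pmf.expectation \<mu> H = measure_pmf.expectation \<mu> G - m * \<rho>"
    unfolding H_def by (simp add: expectation_tally)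
  have "(\<lambda>f. (H f)\<^sup>2) = (\<lambda>f. (G f)\<^sup>2 - 2 * (G f * ?T f) + (?T f)\<^sup>2)"
    by (auto simp: H_def power2_eq_square algebra_simps)
  then have "measure_pmf.expectation \<mu> (\<lambda>f. (H f)\<^sup>2) = measure_pmf.expectation \<mu> (\<lambda>f. (G f)\<^sup>2)
      - 2 * measure_pmf.expectation \<mu> (\<lambda>f. G f * ?T f) + measure_pmf.expectation \<mu> (\<lambda>f. (?T f)\<^sup>2)"
    by simp
  moreover have "measure_pmf.expectation \<mu> (\<lambda>f. (?T f)\<^sup>2) = m * (\<rho> * (1 - \<rho>)) + (m * \<rho>)\<^sup>2"
    using variance_tally unfolding variance_\<mu> by (simp add: expectation_tally)
  ultimately show ?thesis
    unfolding variance_\<mu> unfolding H expectation_tally_mult by (simp add: power2_eq_square algebra_simps)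
qed

end

end

section \<open>Moments of the last-passage time\<close>

lemma tally_increments:
  "(\<And>k. h (Suc k) \<in> {h k, Suc (h k)}) \<Longrightarrow> h 0 + tally (\<lambda>k. h (Suc k) \<noteq> h k) m = h m"
proof (induction m)
  case (Suc m)
  have "h (Suc m) = h m \<or> h (Suc m) = Suc (h m)" using Suc.prems[of m] by simp
  then show ?case using Suc.IH[OF Suc.prems] by auto
qed simp

lemma tally_cong: "(\<And>k. k < m \<Longrightarrow> h k = h' k) \<Longrightarrow> tally h m = tally h' m"
  by (induction m) auto

text \<open>Increments telescope along any monotone way to the corner (n, n): along the bottom and
  right sides, or along the left and top sides. \<open>frontier n n 0\<close> records the right side
  under \<open>Snk\<close> and the top side under \<open>Src\<close>.\<close>

lemma lpp_exit:
  "lpp f n n = tally (\<lambda>k. f (Src k)) n + tally (\<lambda>k. frontier n n 0 f (Snk k)) n"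
  "lpp f n n = tally (\<lambda>k. f (Snk k)) n + tally (\<lambda>k. frontier n n 0 f (Src k)) n"
proof -
  have "tally (\<lambda>k. frontier n n 0 f (Snk k)) n = tally (\<lambda>k. lpp f n (Suc k) \<noteq> lpp f n k) n"
    by (intro tally_cong) auto
  then show "lpp f n n = tally (\<lambda>k. f (Src k)) n + tally (\<lambda>k. frontier n n 0 f (Snk k)) n"
    using tally_increments[of "lpp f n" n] lpp_increments(2)[of f n] lpp_0_right[of f n] by metis
  have "tally (\<lambda>k. frontier n n 0 f (Src k)) n = tally (\<lambda>k. lpp f (Suc k) n \<noteq> lpp f k n) n"
    by (intro tally_cong) auto
  then show "lpp f n n = tally (\<lambda>k. f (Snk k)) n + tally (\<lambda>k. frontier n n 0 f (Src k)) n"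
    using tally_increments[of "\<lambda>k. lpp f k n" n] lpp_increments(1)[of f _ n] lpp.simps(1)[of f n] by metis
qed

context
  fixes n :: nat and p q r :: real
  assumes pqr: "0 \<le> p" "p \<le> 1" "0 \<le> q" "q \<le> 1" "0 \<le> r" "r \<le> 1" "r * (1 - p) * (1 - q) = p * q"
begin

lemma exit_moments:
  "measure_pmf.expectation (law n p q r) (\<lambda>f. tally (\<lambda>k. frontier n n 0 f (Snk k)) n) = n * q"
  "measure_pmf.variance (law n p q r) (\<lambda>f. tally (\<lambda>k. frontier n n 0 f (Snk k)) n) = n * (q * (1 - q))"
  "measure_pmf.variance (law n p q r) (\<lambda>f. tally (\<lambda>k. frontier n n 0 f (Src k)) n) = n * (p * (1 - p))"
proof -
  let ?R = "Pi_pmf (bsites n) False (\<lambda>x. bernoulli_pmf (rate p q r x))"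
  have R: "?R = map_pmf (frontier n n 0) (law n p q r)" using law_frontier[OF pqr, of n n 0] by simp
  have inj: "inj Src" "inj Snk" by (auto simp: inj_def)
  note * = finite_sites(2)[of n] refl[of ?R]
  show "measure_pmf.expectation (law n p q r) (\<lambda>f. tally (\<lambda>k. frontier n n 0 f (Snk k)) n) = n * q"
    "measure_pmf.variance (law n p q r) (\<lambda>f. tally (\<lambda>k. frontier n n 0 f (Snk k)) n) = n * (q * (1 - q))"
    "measure_pmf.variance (law n p q r) (\<lambda>f. tally (\<lambda>k. frontier n n 0 f (Src k)) n) = n * (p * (1 - p))"
    using expectation_tally[OF * inj(2), of n q] variance_tally[OF * inj(2), of n q]
      variance_tally[OF * inj(1), of n p] pqr unfolding R by simp_all
qed

text \<open>Entering and leaving points are dependent, but each count has a known binomial variance,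
  so the covariance with the entering side is the only unknown. The source form leads to the exit
  index, the sink form to the comparison of different tilts.\<close>

lemma lpp_moments:
  "measure_pmf.expectation (law n p q r) (\<lambda>f. lpp f n n) = n * p + n * q"
  "measure_pmf.variance (law n p q r) (\<lambda>f. lpp f n n) = n * (q * (1 - q)) - n * (p * (1 - p))
    + 2 * (p * (1 - p)) * (\<Sum>k<n. measure_pmf.expectation (law n p q r) (\<lambda>f. lpp (f(Src k := True)) n n)
        - measure_pmf.expectation (law n p q r) (\<lambda>f. lpp (f(Src k := False)) n n))"
  "measure_pmf.variance (law n p q r) (\<lambda>f. lpp f n n) = n * (p * (1 - p)) - n * (q * (1 - q))
    + 2 * (q * (1 - q)) * (\<Sum>k<n. measure_pmf.expectation (law n p q r) (\<lambda>f. lpp (f(Snk k := True)) n n)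
        - measure_pmf.expectation (law n p q r) (\<lambda>f. lpp (f(Snk k := False)) n n))"
proof -
  have inj: "inj Src" "inj Snk" by (auto simp: inj_def)
  note * = finite_sites(1)[of n] law_def[of n p q r]
  have H: "real (lpp f n n) - real (tally (\<lambda>k. f (Src k)) n) = tally (\<lambda>k. frontier n n 0 f (Snk k)) n"
    "real (lpp f n n) - real (tally (\<lambda>k. f (Snk k)) n) = tally (\<lambda>k. frontier n n 0 f (Src k)) n" for f
    by (simp add: lpp_exit(1)[of _ n] del: frontier.simps, simp add: lpp_exit(2)[of _ n] del: frontier.simps)
  have "measure_pmf.expectation (law n p q r) (\<lambda>f. real (tally (\<lambda>k. f (Src k)) n)
      + real (tally (\<lambda>k. frontier n n 0 f (Snk k)) n)) = n * p + n * q"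
    using expectation_tally[OF * inj(1), of n p] exit_moments(1) pqr
    by (subst Bochner_Integration.integral_add) (simp_all add: integrable_\<mu>[OF *] del: frontier.simps)
  then show "measure_pmf.expectation (law n p q r) (\<lambda>f. lpp f n n) = n * p + n * q"
    by (subst lpp_exit(1)) (simp del: frontier.simps)
  show "measure_pmf.variance (law n p q r) (\<lambda>f. lpp f n n) = n * (q * (1 - q)) - n * (p * (1 - p))
    + 2 * (p * (1 - p)) * (\<Sum>k<n. measure_pmf.expectation (law n p q r) (\<lambda>f. lpp (f(Src k := True)) n n)
        - measure_pmf.expectation (law n p q r) (\<lambda>f. lpp (f(Src k := False)) n n))"
    using variance_via_tally[OF * inj(1), of n p "\<lambda>f. lpp f n n"] pqr
    unfolding H exit_moments(2,3) by (simp del: frontier.simps fun_upd_apply)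
  show "measure_pmf.variance (law n p q r) (\<lambda>f. lpp f n n) = n * (p * (1 - p)) - n * (q * (1 - q))
    + 2 * (q * (1 - q)) * (\<Sum>k<n. measure_pmf.expectation (law n p q r) (\<lambda>f. lpp (f(Snk k := True)) n n)
        - measure_pmf.expectation (law n p q r) (\<lambda>f. lpp (f(Snk k := False)) n n))"
    using variance_via_tally[OF * inj(2), of n q "\<lambda>f. lpp f n n"] pqr
    unfolding H exit_moments(2,3) by (simp del: frontier.simps fun_upd_apply)
qed

end

section \<open>Tail of the exit point on the lattice\<close>

lemma bernoulli_monotone_coupling:
  assumes "0 \<le> \<rho>" "\<rho> \<le> \<rho>'" "\<rho>' \<le> 1"
  obtains K :: "(bool \<times> bool) pmf" where
    "map_pmf fst K = bernoulli_pmf \<rho>" "map_pmf snd K = bernoulli_pmf \<rho>'"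
    "map_pmf (\<lambda>(a, b). b \<and> \<not> a) K = bernoulli_pmf (\<rho>' - \<rho>)"
    "\<And>x. x \<in> set_pmf K \<Longrightarrow> fst x \<longrightarrow> snd x"
proof -
  \<comment> \<open>The chance of adding a point where there is none, so that the total probability
    becomes \<open>\<rho>'\<close>. For \<open>\<rho> = 1\<close> the quotient is 0 by convention,
    which is correct because then \<open>\<rho>' = 1\<close>.\<close>
  define e where "e = (\<rho>' - \<rho>) / (1 - \<rho>)"
  have e: "0 \<le> e" "e \<le> 1" "\<rho> + (1 - \<rho>) * e = \<rho>'"
    using assms by (auto simp: e_def field_simps divide_simps)
  define K where "K = bind_pmf (bernoulli_pmf \<rho>) (\<lambda>a. map_pmf (\<lambda>b. (a, a \<or> b)) (bernoulli_pmf e))"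
  show thesis
  proof
    show "map_pmf fst K = bernoulli_pmf \<rho>"
      unfolding K_def map_bind_pmf map_pmf_comp by (simp add: bind_return_pmf')
    show "map_pmf snd K = bernoulli_pmf \<rho>'"
    proof (rule pmf_eqI)
      fix i show "pmf (map_pmf snd K) i = pmf (bernoulli_pmf \<rho>') i"
        unfolding K_def map_bind_pmf map_pmf_comp map_pmf_def[of _ "bernoulli_pmf e"]
        using assms e by (cases i) (auto simp: pmf_bind algebra_simps)
    qed
    show "map_pmf (\<lambda>(a, b). b \<and> \<not> a) K = bernoulli_pmf (\<rho>' - \<rho>)"
    proof (rule pmf_eqI)
      fix i show "pmf (map_pmf (\<lambda>(a, b). b \<and> \<not> a) K) i = pmf (bernoulli_pmf (\<rho>' - \<rho>)) i"
        unfolding K_def map_bind_pmf map_pmf_comp map_pmf_def[of _ "bernoulli_pmf e"]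
        using assms e by (cases i) (auto simp: pmf_bind algebra_simps)
    qed
    show "fst x \<longrightarrow> snd x" if "x \<in> set_pmf K" for x
      using that by (auto simp: K_def)
  qed
qed

text \<open>Used for three quantities on one coupling that are not independent; the factor 3 is the
  price.\<close>

lemma variance_add3_le:
  fixes X Y Z :: "'a \<Rightarrow> real"
  assumes fin: "finite (set_pmf \<mu>)"
  shows "measure_pmf.variance \<mu> (\<lambda>x. X x + Y x + Z x) \<le>
    3 * (measure_pmf.variance \<mu> X + measure_pmf.variance \<mu> Y + measure_pmf.variance \<mu> Z)"
proof -
  have [simp]: "integrable (measure_pmf \<mu>) (g :: 'a \<Rightarrow> real)" for g
    using fin by (rule integrable_measure_pmf_finite)
  have ineq: "(a + b + c)\<^sup>2 \<le> 3 * (a\<^sup>2 + b\<^sup>2 + c\<^sup>2)" for a b c :: real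
  proof -
    have "0 \<le> (a - b)\<^sup>2 + (b - c)\<^sup>2 + (a - c)\<^sup>2" by simp
    then show ?thesis by (simp add: power2_eq_square algebra_simps)
  qed
  let ?E = "measure_pmf.expectation \<mu>"
  have "measure_pmf.variance \<mu> (\<lambda>x. X x + Y x + Z x) =
      ?E (\<lambda>x. ((X x - ?E X) + (Y x - ?E Y) + (Z x - ?E Z))\<^sup>2)"
    by (simp add: algebra_simps)
  also have "\<dots> \<le> ?E (\<lambda>x. 3 * ((X x - ?E X)\<^sup>2 + (Y x - ?E Y)\<^sup>2 + (Z x - ?E Z)\<^sup>2))"
    by (intro integral_mono ineq) simp_all
  finally show ?thesis by simp
qed

text \<open>With equal source and sink rates the variances of entering and leaving points cancel.
  What remains is the influence of the sources, and summing the bound of \<open>lpp_Src_upd\<close>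
  over k counts the sites below the exit index.\<close>

lemma variance_lpp_le_exit_index:
  assumes p: "0 \<le> p" "p < 1" and r: "0 \<le> r" "r \<le> 1" and eq: "r * (1 - p) * (1 - p) = p * p"
  shows "measure_pmf.variance (law n p p r) (\<lambda>f. lpp f n n) \<le>
    2 * p * measure_pmf.expectation (law n p p r) (\<lambda>f. exit_index f n)"
proof -
  let ?\<mu> = "law n p p r" and ?E = "measure_pmf.expectation (law n p p r)"
  note * = finite_sites(1)[of n] law_def[of n p p r]
  have [simp]: "integrable (measure_pmf ?\<mu>) (g :: _ \<Rightarrow> real)" for g by (rule integrable_\<mu>[OF *])
  have one: "(1 - p) * (?E (\<lambda>f. lpp (f(Src k := True)) n n) - ?E (\<lambda>f. lpp (f(Src k := False)) n n))
      \<le> ?E (\<lambda>f. of_bool (k < exit_index f n))" if k: "k < n" for k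
  proof -
    have "?E (\<lambda>f. lpp (f(Src k := True)) n n)
      \<le> ?E (\<lambda>f. real (lpp (f(Src k := False)) n n) + of_bool (k < exit_index (f(Src k := False)) n))"
    proof (intro integral_mono)
      fix f
      show "real (lpp (f(Src k := True)) n n)
          \<le> real (lpp (f(Src k := False)) n n) + of_bool (k < exit_index (f(Src k := False)) n)"
        using of_nat_mono[OF lpp_Src_upd[OF k, of f], where 'a = real] by simp
    qed simp_all
    then have "?E (\<lambda>f. lpp (f(Src k := True)) n n) - ?E (\<lambda>f. lpp (f(Src k := False)) n n)
      \<le> ?E (\<lambda>f. of_bool (k < exit_index (f(Src k := False)) n))" by simp
    \<comment> \<open>The exit index is evaluated without the source k. Multiplying by 1 - p, the
      probability that this source is absent, turns the bound into an event for the configuration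
      itself.\<close>
    then have "(1 - p) * (?E (\<lambda>f. lpp (f(Src k := True)) n n) - ?E (\<lambda>f. lpp (f(Src k := False)) n n))
      \<le> (1 - p) * ?E (\<lambda>f. of_bool (k < exit_index (f(Src k := False)) n))"
      using p by (intro mult_left_mono) auto
    also have "\<dots> = ?E (\<lambda>f. of_bool (\<not> f (Src k) \<and> k < exit_index f n))"
      using expectation_resample[OF *, of "Src k" p "\<lambda>f. of_bool (\<not> f (Src k) \<and> k < exit_index f n)"] p k
      by simp
    also have "\<dots> \<le> ?E (\<lambda>f. of_bool (k < exit_index f n))"
      by (intro integral_mono) auto
    finally show ?thesis .
  qed
  have exit_index: "(\<Sum>k<n. of_bool (k < exit_index f n)) = real (exit_index f n)" for f
  proof -
    have "{..<n} \<inter> {k. k < exit_index f n} = {..<exit_index f n}" using exit_index_le[of f n] by auto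
    then show ?thesis by (simp add: sum.If_cases of_bool_def)
  qed
  have "measure_pmf.variance ?\<mu> (\<lambda>f. lpp f n n) = 2 * p * (\<Sum>k<n. (1 - p) *
     (?E (\<lambda>f. lpp (f(Src k := True)) n n) - ?E (\<lambda>f. lpp (f(Src k := False)) n n)))"
    using lpp_moments(2)[of p p r n] p r eq by (simp add: sum_distrib_left mult.assoc)
  also have "\<dots> \<le> 2 * p * (\<Sum>k<n. ?E (\<lambda>f. of_bool (k < exit_index f n)))"
    using p one by (intro mult_left_mono sum_mono) auto
  also have "(\<Sum>k<n. ?E (\<lambda>f. of_bool (k < exit_index f n))) = ?E (\<lambda>f. exit_index f n)"
    by (subst Bochner_Integration.integral_sum[symmetric]) (simp_all only: exit_index integrable_\<mu>[OF *])
  finally show ?thesis .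
qed

text \<open>The proof studies W, the number of added sources on the first m sites minus the gain of
  the last-passage time under the tilt. Its mean is at least D > 0, but W is at most 0 whenever the
  exit index reaches m.\<close>

lemma exit_index_tail_discrete:
  fixes n m :: nat and s :: real
  assumes m: "1 \<le> m" "m \<le> n" and s: "0 < s" "s \<le> 1 / 10"
  defines "\<mu> \<equiv> law n (s / (1 + s)) (s / (1 + s)) (s\<^sup>2)"
  shows "measure_pmf.prob \<mu> {f. m \<le> exit_index f n}
    \<le> 192 * n ^ 2 * (2 * real m + 4 * measure_pmf.expectation \<mu> (\<lambda>f. exit_index f n)) / (s * m ^ 4)"
proof -
  \<comment> \<open>To leading order the mean of W is s (m x - n x^2) for a tilt 1 + x; this x
    maximises it.\<close>
  define \<delta> where "\<delta> = real m / (2 * real n)"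
  define l where "l = 1 + \<delta>"
  define p where "p = s / (1 + s)"
  \<comment> \<open>Occupation probabilities with odds l s for sources and s / l for sinks. The
    product of the odds remains s^2, so the tilted model is stationary with the same bulk
    points.\<close>
  define pl where "pl = l * s / (1 + l * s)"
  define ql where "ql = s / (l + s)"
  have n: "0 < n" using m by linarith
  have \<delta>: "0 < \<delta>" "\<delta> \<le> 1 / 2" using m by (auto simp: \<delta>_def field_simps)
  have m\<delta>: "real m = 2 * real n * \<delta>" using n by (simp add: \<delta>_def)
  have l: "1 < l" "l \<le> 3 / 2" using \<delta> by (auto simp: l_def)
  have pos: "0 < 1 + s" "0 < 1 + l * s" "0 < l + s" "0 \<le> l * s"
    using s l by (auto intro!: add_pos_nonneg)
  have p: "0 \<le> p" "p < 1" "p \<le> s" using s by (auto simp: p_def field_simps)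
  have d: "pl - p = s * \<delta> / ((1 + l * s) * (1 + s))"
    using pos by (simp add: pl_def p_def l_def field_simps)
  have d': "p - ql = s * \<delta> / ((1 + s) * (l + s))"
    using pos by (simp add: ql_def p_def l_def field_simps)
  have pl: "p \<le> pl" "pl \<le> 1" using d pos s \<delta> by (smt (verit) divide_nonneg_nonneg mult_nonneg_nonneg)
      (use pos in \<open>simp add: pl_def field_simps\<close>)
  have ql: "0 \<le> ql" "ql \<le> p" using d' pos s \<delta>
    by (simp add: ql_def) (smt (verit) d' pos s \<delta> divide_nonneg_nonneg mult_nonneg_nonneg)
  have r: "0 \<le> s\<^sup>2" "s\<^sup>2 \<le> 1" using s by (auto simp: power_le_one)
  have stat1: "s\<^sup>2 * (1 - p) * (1 - p) = p * p"
    using pos by (simp add: p_def field_simps power2_eq_square)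
  have statl: "s\<^sup>2 * (1 - pl) * (1 - ql) = pl * ql"
    using pos by (simp add: pl_def ql_def field_simps power2_eq_square)

  obtain K1 :: "(bool \<times> bool) pmf" where K1:
    "map_pmf fst K1 = bernoulli_pmf p" "map_pmf snd K1 = bernoulli_pmf pl"
    "map_pmf (\<lambda>(a, b). b \<and> \<not> a) K1 = bernoulli_pmf (pl - p)"
    "\<And>x. x \<in> set_pmf K1 \<Longrightarrow> fst x \<longrightarrow> snd x"
    by (rule bernoulli_monotone_coupling[OF p(1) pl]) blast
  obtain K2 :: "(bool \<times> bool) pmf" where K2:
    "map_pmf fst K2 = bernoulli_pmf ql" "map_pmf snd K2 = bernoulli_pmf p"
    "\<And>x. x \<in> set_pmf K2 \<Longrightarrow> fst x \<longrightarrow> snd x"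
    by (rule bernoulli_monotone_coupling[OF ql less_imp_le[OF p(2)]]) blast
  \<comment> \<open>The first component is the original model, the second the tilted one. Sources
    are ordered upwards and bulk points are shared; tilting removes sinks, hence the swap.\<close>
  define K where "K x = (case x of Src k \<Rightarrow> K1 | Snk k \<Rightarrow> map_pmf prod.swap K2
      | Bulk k l \<Rightarrow> map_pmf (\<lambda>a. (a, a)) (bernoulli_pmf (s\<^sup>2)))" for x
  define \<nu> where "\<nu> = Pi_pmf (sites n) (False, False) K"
  have Kfst: "map_pmf fst (K x) = bernoulli_pmf (rate p p (s\<^sup>2) x)" for x
    by (cases x) (auto simp: K_def K1 K2 map_pmf_comp)
  have Ksnd: "map_pmf snd (K x) = bernoulli_pmf (rate pl ql (s\<^sup>2) x)" for x
    by (cases x) (auto simp: K_def K1 K2 map_pmf_comp)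
  have law1: "law n p p (s\<^sup>2) = map_pmf (\<lambda>g. fst \<circ> g) \<nu>"
    unfolding law_def \<nu>_def Kfst[symmetric] by (rule Pi_pmf_map) auto
  have lawl: "law n pl ql (s\<^sup>2) = map_pmf (\<lambda>g. snd \<circ> g) \<nu>"
    unfolding law_def \<nu>_def Ksnd[symmetric] by (rule Pi_pmf_map) auto
  have supp: "g x \<in> insert (False, False) (set_pmf (K x))" if "g \<in> set_pmf \<nu>" for g x
    using that by (auto simp: \<nu>_def set_Pi_pmf PiE_dflt_def)
  have mono1: "snd (g (Src k))" if "g \<in> set_pmf \<nu>" "fst (g (Src k))" for g k
    using supp[OF that(1), of "Src k"] that(2) K1(4)[of "g (Src k)"] by (auto simp: K_def)
  have mono2: "fst (g (Snk k))" if "g \<in> set_pmf \<nu>" "snd (g (Snk k))" for g k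
    using supp[OF that(1), of "Snk k"] that(2) K2(3)[of "prod.swap (g (Snk k))"] by (auto simp: K_def)
  have mono3: "fst (g (Bulk k l)) = snd (g (Bulk k l))" if "g \<in> set_pmf \<nu>" for g k l
    using supp[OF that(1), of "Bulk k l"] by (auto simp: K_def)
  have int [simp]: "integrable (measure_pmf \<nu>) (h :: _ \<Rightarrow> real)" for h by (simp add: \<nu>_def)
  have fin: "finite (set_pmf \<nu>)"
    by (auto simp: \<nu>_def set_Pi_pmf intro!: finite_PiE_dflt)
  let ?E = "measure_pmf.expectation \<nu>" and ?V = "measure_pmf.variance \<nu>"
  define L1 Ll where "L1 g = real (lpp (fst \<circ> g) n n)" and "Ll g = real (lpp (snd \<circ> g) n n)" for g :: "site \<Rightarrow> bool \<times> bool"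
  define Ez where "Ez = measure_pmf.expectation \<mu> (\<lambda>f. exit_index f n)"
  have \<mu>: "\<mu> = law n p p (s\<^sup>2)" by (simp add: \<mu>_def p_def)
  have Ez0: "0 \<le> Ez" by (simp add: Ez_def)

  have V1: "?V L1 \<le> 2 * p * Ez"
    using variance_lpp_le_exit_index[OF p(1,2) r stat1, of n] unfolding Ez_def \<mu> law1 L1_def by simp
  define D1 Dl where
    "D1 = (\<Sum>k<n. ?E (\<lambda>g. lpp ((fst \<circ> g)(Snk k := True)) n n) - ?E (\<lambda>g. lpp ((fst \<circ> g)(Snk k := False)) n n))"
    and "Dl = (\<Sum>k<n. ?E (\<lambda>g. lpp ((snd \<circ> g)(Snk k := True)) n n) - ?E (\<lambda>g. lpp ((snd \<circ> g)(Snk k := False)) n n))"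
  have V1': "?V L1 = 2 * (p * (1 - p)) * D1"
    using lpp_moments(3)[of p p "s\<^sup>2" n] p r stat1 unfolding law1 L1_def D1_def by simp
  \<comment> \<open>The sink form is essential here: \<open>lpp_Snk_upd_antimono\<close> bounds the
    influence \<open>Dl\<close> by that of the untilted model, whereas the source form would need
    the exit index of the tilted one.\<close>
  have Vl: "?V Ll = n * (pl * (1 - pl)) - n * (ql * (1 - ql)) + 2 * (ql * (1 - ql)) * Dl"
    using lpp_moments(3)[of pl ql "s\<^sup>2" n] p pl ql r statl unfolding lawl Ll_def Dl_def by simp
  have D1_nonneg: "0 \<le> D1"
    unfolding D1_def by (intro sum_nonneg) (auto intro!: integral_mono lpp_mono split: if_splits)
  have "Dl \<le> D1"
    unfolding D1_def Dl_def
  proof (intro sum_mono)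
    fix k assume "k \<in> {..<n}"
    then have k: "k < n" by simp
    have "?E (\<lambda>g. real (lpp ((snd \<circ> g)(Snk k := True)) n n) - real (lpp ((snd \<circ> g)(Snk k := False)) n n))
      \<le> ?E (\<lambda>g. real (lpp ((fst \<circ> g)(Snk k := True)) n n) - real (lpp ((fst \<circ> g)(Snk k := False)) n n))"
    proof (intro integral_mono_AE AE_pmfI)
      fix g assume g: "g \<in> set_pmf \<nu>"
      have "int (lpp ((snd \<circ> g)(Snk k := True)) n n) - int (lpp ((snd \<circ> g)(Snk k := False)) n n)
        \<le> int (lpp ((fst \<circ> g)(Snk k := True)) n n) - int (lpp ((fst \<circ> g)(Snk k := False)) n n)"
        using mono1[OF g] mono2[OF g] mono3[OF g] by (intro lpp_Snk_upd_antimono k) auto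
      then show "real (lpp ((snd \<circ> g)(Snk k := True)) n n) - real (lpp ((snd \<circ> g)(Snk k := False)) n n)
        \<le> real (lpp ((fst \<circ> g)(Snk k := True)) n n) - real (lpp ((fst \<circ> g)(Snk k := False)) n n)"
        by linarith
    qed simp_all
    then show "?E (\<lambda>g. lpp ((snd \<circ> g)(Snk k := True)) n n) - ?E (\<lambda>g. lpp ((snd \<circ> g)(Snk k := False)) n n)
      \<le> ?E (\<lambda>g. lpp ((fst \<circ> g)(Snk k := True)) n n) - ?E (\<lambda>g. lpp ((fst \<circ> g)(Snk k := False)) n n)"
      by (simp del: fun_upd_apply)
  qed
  moreover have "ql * (1 - ql) \<le> p * (1 - p)"
  proof -
    have "0 \<le> (p - ql) * (1 - p - ql)" using ql p s by (intro mult_nonneg_nonneg) auto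
    then show ?thesis by (simp add: algebra_simps)
  qed
  ultimately have "ql * (1 - ql) * Dl \<le> p * (1 - p) * D1"
    using D1_nonneg ql p by (smt (verit) mult_mono mult_nonneg_nonneg mult_left_mono)
  then have Vl_le: "?V Ll \<le> n * (pl * (1 - pl) - ql * (1 - ql)) + ?V L1"
    unfolding Vl V1' by (simp add: algebra_simps)
  have "pl * (1 - pl) - ql * (1 - ql) \<le> 2 * s * \<delta>"
  proof -
    have "pl * (1 - pl) - ql * (1 - ql) = (pl - ql) * (1 - (pl + ql))" by (simp add: algebra_simps)
    also have "\<dots> \<le> (pl - ql) * 1" using pl ql p by (intro mult_left_mono) auto
    also have "pl - ql = s * (\<delta> * (l + 1)) / ((1 + l * s) * (l + s))"
      using pos by (simp add: pl_def ql_def l_def field_simps)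
    also have "\<dots> \<le> s * (\<delta> * (l + 1)) / (1 * l)"
    proof (intro divide_left_mono)
      show "1 * l \<le> (1 + l * s) * (l + s)" using pos(4) l s by (intro mult_mono) auto
      show "0 < (1 + l * s) * (l + s) * (1 * l)" using pos l by simp
    qed (use l s \<delta> in simp)
    also have "\<dots> \<le> 2 * s * \<delta>" using l s \<delta> by (simp add: field_simps)
    finally show ?thesis by simp
  qed
  then have "n * (pl * (1 - pl) - ql * (1 - ql)) \<le> n * (2 * s * \<delta>)" by (intro mult_left_mono) auto
  also have "\<dots> = s * m" using n by (simp add: \<delta>_def)
  finally have Vl': "?V Ll \<le> s * m + ?V L1" using Vl_le by linarith

  define X where "X g = real (tally (\<lambda>k. snd (g (Src k)) \<and> \<not> fst (g (Src k))) m)" for g :: "site \<Rightarrow> bool \<times> bool"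
  define \<kappa> where "\<kappa> = Pi_pmf (sites n) False (\<lambda>x. map_pmf (\<lambda>(a, b). b \<and> \<not> a) (K x))"
  have \<kappa>: "\<kappa> = map_pmf (\<lambda>g. (\<lambda>(a, b). b \<and> \<not> a) \<circ> g) \<nu>"
    unfolding \<kappa>_def \<nu>_def by (rule Pi_pmf_map) auto
  note X_tally = finite_sites(1)[of n] \<kappa>_def
  have inj: "inj Src" by (auto simp: inj_def)
  have KSrc: "map_pmf (\<lambda>(a, b). b \<and> \<not> a) (K (Src k)) = bernoulli_pmf (pl - p)" for k
    by (simp add: K_def K1)
  have dpl: "0 \<le> pl - p" "pl - p \<le> 1" using pl p by auto
  have EX: "?E X = m * (pl - p)"
    using expectation_tally[OF X_tally inj _ KSrc dpl, of m] m unfolding X_def \<kappa>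
    by (simp add: case_prod_unfold)
  have VX: "?V X = m * ((pl - p) * (1 - (pl - p)))"
    using variance_tally[OF X_tally inj _ KSrc dpl, of m] m unfolding X_def \<kappa>
    by (simp add: case_prod_unfold)
  have "s * \<delta> / ((1 + l * s) * (1 + s)) \<le> s * \<delta> / 1"
  proof (intro divide_left_mono)
    show "1 \<le> (1 + l * s) * (1 + s)" using mult_mono[of 1 "1 + l * s" 1 "1 + s"] pos(4) s by simp
  qed (use pos s \<delta> in simp_all)
  then have "pl - p \<le> s * \<delta>" unfolding d by simp
  then have "(pl - p) * (1 - (pl - p)) \<le> s * \<delta> * 1" using dpl by (intro mult_mono) auto
  then have "m * ((pl - p) * (1 - (pl - p))) \<le> m * (s * \<delta>)" by (intro mult_left_mono) auto
  also have "m * (s * \<delta>) \<le> m * (s * (1 / 2))" using \<delta> s by (intro mult_left_mono) auto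
  finally have VX': "?V X \<le> s * m / 2" unfolding VX by (simp add: mult.commute)

  define W where "W g = X g + - Ll g + L1 g" for g
  have EL: "?E L1 = n * p + n * p" "?E Ll = n * pl + n * ql"
    using lpp_moments(1)[of p p "s\<^sup>2" n] lpp_moments(1)[of pl ql "s\<^sup>2" n] p pl ql r stat1 statl
    unfolding law1 lawl L1_def Ll_def by simp_all
  have "?V W \<le> 3 * (?V X + ?V (\<lambda>g. - Ll g) + ?V L1)"
    unfolding W_def by (rule variance_add3_le[OF fin])
  also have "?V (\<lambda>g. - Ll g) = ?V Ll" by (simp add: power2_commute)
  finally have "?V W \<le> 3 * (s * m / 2 + (s * m + 2 * p * Ez) + 2 * p * Ez)" using VX' Vl' V1 by argo
  also have "\<dots> \<le> 3 * s * (2 * real m + 4 * Ez)"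
  proof -
    have "p * Ez \<le> s * Ez" using p Ez0 by (intro mult_right_mono) auto
    moreover have "0 \<le> s * m" using s by simp
    moreover have "3 * s * (2 * real m + 4 * Ez) = 6 * (s * m) + 12 * (s * Ez)" by (simp add: algebra_simps)
    moreover have "3 * (s * m / 2 + (s * m + 2 * p * Ez) + 2 * p * Ez) = 9 / 2 * (s * m) + 12 * (p * Ez)"
      by (simp add: algebra_simps)
    ultimately show ?thesis by argo
  qed
  finally have VW: "?V W \<le> 3 * s * (2 * real m + 4 * Ez)" .

  \<comment> \<open>This is \<open>n * s * \<delta>\<^sup>2 / 2\<close> written in m and n. Its 8,
    squared, times the 3 from \<open>variance_add3_le\<close> makes the constant 192.\<close>
  define D where "D = s * m ^ 2 / (8 * n)"
  have D: "0 < D" using s m n by (simp add: D_def)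
  have EW: "D \<le> ?E W"
  proof -
    \<comment> \<open>The choice of \<open>\<delta>\<close> pays off: the added sources have mean
      exactly 2 c, while the mean gain of the last-passage time is c (1 - s) / (l + s), at most
      c.\<close>
    define c where "c = n * s * \<delta>\<^sup>2 / ((1 + l * s) * (1 + s))"
    have "?E W = m * (pl - p) - n * (pl + ql - 2 * p)"
      unfolding W_def by (simp add: EX EL algebra_simps)
    also have "pl + ql - 2 * p = s * (1 - s) * \<delta>\<^sup>2 / ((1 + s) * (1 + l * s) * (l + s))"
    proof -
      have frac: "x / (a * c) - x / (c * b) = x * (b - a) / (c * a * b)"
        if "a \<noteq> 0" "b \<noteq> 0" "c \<noteq> 0" for a b c x :: real
        using that by (simp add: field_simps)
      have "pl + ql - 2 * p = (pl - p) - (p - ql)" by simp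
      also have "\<dots> = s * \<delta> * ((l + s) - (1 + l * s)) / ((1 + s) * (1 + l * s) * (l + s))"
        unfolding d d' using pos by (intro frac) auto
      also have "(l + s) - (1 + l * s) = \<delta> * (1 - s)" by (simp add: l_def algebra_simps)
      finally show ?thesis by (simp add: power2_eq_square mult_ac)
    qed
    also have "m * (pl - p) = 2 * c"
      unfolding d c_def m\<delta> by (simp add: power2_eq_square)
    also have "n * (s * (1 - s) * \<delta>\<^sup>2 / ((1 + s) * (1 + l * s) * (l + s))) = c * ((1 - s) / (l + s))"
      unfolding c_def by (simp add: mult_ac)
    finally have EWc: "?E W = c * (2 - (1 - s) / (l + s))" by (simp add: algebra_simps)
    have c: "0 \<le> c" using s \<delta> pos by (auto simp: c_def)
    have "(1 - s) / (l + s) \<le> 1" using s l by simp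
    then have "c * 1 \<le> ?E W" unfolding EWc using c by (intro mult_left_mono) auto
    moreover have "n * s * \<delta>\<^sup>2 / 2 \<le> c"
      unfolding c_def
    proof (intro divide_left_mono)
      have "l * s \<le> 3 / 2 * (1 / 10)" using l s by (intro mult_mono) auto
      then have "(1 + l * s) * (1 + s) \<le> (1 + 3 / 20) * (1 + 1 / 10)" using s pos by (intro mult_mono) auto
      then show "(1 + l * s) * (1 + s) \<le> 2" by simp
    qed (use s pos in auto)
    moreover have "n * s * \<delta>\<^sup>2 / 2 = D" using n by (simp add: D_def \<delta>_def power2_eq_square)
    ultimately show ?thesis by linarith
  qed

  \<comment> \<open>An optimal path of the original model, leaving at its exit index z, competes in
    the tilted model with the same bulk chain and collects every source added below z, in particular
    those below m.\<close>
  have W_nonpos: "W g \<le> 0" if g: "g \<in> set_pmf \<nu>" and "m \<le> exit_index (fst \<circ> g) n" for g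
  proof -
    define z where "z = exit_index (fst \<circ> g) n"
    have z: "m \<le> z" "z \<le> n" using that exit_index_le[of "fst \<circ> g" n] by (auto simp: z_def)
    have "boundary_count (fst \<circ> g) (int z) + bulk_length (fst \<circ> g) n (int z) = lpp (fst \<circ> g) n n"
      unfolding z_def using z m by (intro exit_index_maximizer) (simp add: z_def)
    moreover have "boundary_count (snd \<circ> g) (int z) + bulk_length (snd \<circ> g) n (int z) \<le> lpp (snd \<circ> g) n n"
      using z by (intro lpp_ge) auto
    moreover have "bulk_length (snd \<circ> g) n (int z) = bulk_length (fst \<circ> g) n (int z)"
      using mono3[OF g] by (intro bulk_length_cong) simp
    moreover have "tally (\<lambda>k. snd (g (Src k))) z =
      tally (\<lambda>k. fst (g (Src k))) z + tally (\<lambda>k. snd (g (Src k)) \<and> \<not> fst (g (Src k))) z"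
    proof (induction z)
      case (Suc k)
      then show ?case using mono1[OF g, of k] by auto
    qed simp
    moreover have "tally (\<lambda>k. snd (g (Src k)) \<and> \<not> fst (g (Src k))) m
        \<le> tally (\<lambda>k. snd (g (Src k)) \<and> \<not> fst (g (Src k))) z"
      by (rule tally_mono[OF z(1)])
    ultimately show ?thesis unfolding W_def X_def L1_def Ll_def by (simp add: boundary_count_def)
  qed
  have "measure_pmf.prob \<mu> {f. m \<le> exit_index f n} = measure_pmf.prob \<nu> {g. m \<le> exit_index (fst \<circ> g) n}"
    unfolding \<mu> law1 by (simp add: vimage_def)
  also have "\<dots> \<le> measure_pmf.prob \<nu> {g \<in> space \<nu>. D \<le> \<bar>W g - ?E W\<bar>}"
    using W_nonpos EW by (intro measure_pmf.finite_measure_mono_AE AE_pmfI) fastforce+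
  also have "\<dots> \<le> ?V W / D\<^sup>2"
    using D by (intro measure_pmf.Chebyshev_inequality) auto
  also have "\<dots> \<le> 3 * s * (2 * real m + 4 * Ez) / D\<^sup>2"
    using VW D by (intro divide_right_mono) auto
  also have "\<dots> = 192 * n ^ 2 * (2 * real m + 4 * Ez) / (s * m ^ 4)"
    unfolding D_def using s m n by (simp add: field_simps power2_eq_square power4_eq_xxxx)
  finally show ?thesis unfolding Ez_def .
qed

section \<open>Discretisation of a locally finite configuration\<close>

definition cell :: "real \<Rightarrow> nat \<Rightarrow> real set" where
  "cell a k = {real k * a<..real (Suc k) * a}"

text \<open>Cells are open on the left, so a positive multiple \<open>k * a\<close> belongs to cell
  k - 1; hence the ceiling minus one.\<close>

definition cell_index :: "real \<Rightarrow> real \<Rightarrow> nat" where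
  "cell_index a x = nat (\<lceil>x / a\<rceil> - 1)"

text \<open>The bulk cells have a side \<open>b\<close> slightly larger than \<open>a\<close>, which leaves room to satisfy the
  stationarity relation exactly.\<close>

definition grid :: "real \<Rightarrow> real \<Rightarrow> nat \<Rightarrow> (real \<times> real) set \<Rightarrow> real set \<Rightarrow> real set \<Rightarrow> site \<Rightarrow> bool" where
  "grid a b n al sr sk x \<longleftrightarrow> x \<in> sites n \<and>
     (case x of Src k \<Rightarrow> card (sr \<inter> cell a k) \<noteq> 0
        | Snk k \<Rightarrow> card (sk \<inter> cell a k) \<noteq> 0
        | Bulk k l \<Rightarrow> card (al \<inter> cell b k \<times> cell b l) \<noteq> 0)"

lemma bounded_cell [simp]: "bounded (cell a k)"
  by (simp add: cell_def)

lemma cell_index: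
  assumes "0 < a" "0 < x"
  shows "x \<in> cell a (cell_index a x)"
proof -
  have "0 < x / a" using assms by simp
  then have c: "1 \<le> \<lceil>x / a\<rceil>" by linarith
  then have 1: "real (cell_index a x) = of_int \<lceil>x / a\<rceil> - 1" by (simp add: cell_index_def)
  have "of_int \<lceil>x / a\<rceil> - 1 < x / a" "x / a \<le> of_int \<lceil>x / a\<rceil>" by linarith+
  then have "real (cell_index a x) < x / a" "x / a \<le> real (Suc (cell_index a x))" using 1 by auto
  then show ?thesis using assms unfolding cell_def
    by (simp add: pos_less_divide_eq pos_divide_le_eq)
qed

lemma cell_index_less:
  assumes "0 < a" "0 < x" "x \<le> real m * a"
  shows "cell_index a x < m"
proof -
  have "real (cell_index a x) * a < real m * a" using cell_index[OF assms(1,2)] assms(3) by (auto simp: cell_def)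
  then show ?thesis using assms(1) by simp
qed

lemma cell_index_ge:
  assumes "0 < a" "0 < x" "real m * a < x"
  shows "m \<le> cell_index a x"
proof -
  have "real m * a < real (Suc (cell_index a x)) * a"
    using cell_index[OF assms(1,2)] assms(3) by (auto simp: cell_def)
  then have "real m < real (Suc (cell_index a x))" using assms(1) mult_less_cancel_right_pos by blast
  then show ?thesis by linarith
qed

lemma cell_index_strict:
  assumes "0 < a" "0 < x" "x + a < y"
  shows "cell_index a x < cell_index a y"
proof -
  have "real (cell_index a x) * a < x" using cell_index[OF assms(1,2)] by (auto simp: cell_def)
  then have "real (Suc (cell_index a x)) * a < y" using assms(3) by (simp add: algebra_simps)
  then show ?thesis using cell_index_ge[of a y "Suc (cell_index a x)"] assms by simp
qed

lemma tally_cells_le: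
  assumes "0 < a" and fin: "\<And>B. bounded B \<Longrightarrow> finite (S \<inter> B)" and y: "real m * a \<le> y"
  shows "tally (\<lambda>k. k < n \<and> card (S \<inter> cell a k) \<noteq> 0) m \<le> card (S \<inter> {0<..y})"
proof -
  have "tally (\<lambda>k. k < n \<and> card (S \<inter> cell a k) \<noteq> 0) m \<le> card (S \<inter> {0<..real m * a})"
  proof (induction m)
    case (Suc m)
    have eq: "S \<inter> {0<..real (Suc m) * a} = (S \<inter> {0<..real m * a}) \<union> (S \<inter> cell a m)"
    proof -
      have "real m * a \<le> real (Suc m) * a" "0 \<le> real m * a" using assms(1) by auto
      then show ?thesis by (auto simp: cell_def simp del: of_nat_Suc)
    qed
    have "card (S \<inter> {0<..real (Suc m) * a}) = card (S \<inter> {0<..real m * a}) + card (S \<inter> cell a m)"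
      unfolding eq by (intro card_Un_disjoint fin) (auto simp: cell_def)
    then show ?case using Suc by (cases "card (S \<inter> cell a m) = 0") auto
  qed simp
  also have "\<dots> \<le> card (S \<inter> {0<..y})"
    using y by (intro card_mono fin) auto
  finally show ?thesis .
qed

text \<open>Occupied cells undercount points only when two points share a cell; the gap condition
  makes \<open>cell_index\<close> injective on them.\<close>

lemma card_le_tally_cells:
  assumes "0 < a" and fin: "\<And>B. bounded B \<Longrightarrow> finite (S \<inter> B)" and y: "y \<le> real m * a" "m \<le> n"
    and gap: "\<And>u v. u \<in> S \<inter> {0<..y} \<Longrightarrow> v \<in> S \<inter> {0<..y} \<Longrightarrow> u < v \<Longrightarrow> u + a < v"
  shows "card (S \<inter> {0<..y}) \<le> tally (\<lambda>k. k < n \<and> card (S \<inter> cell a k) \<noteq> 0) m"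
proof -
  have "inj_on (cell_index a) (S \<inter> {0<..y})"
  proof (rule linorder_inj_onI)
    fix u v assume "u < v" "u \<in> S \<inter> {0<..y}" "v \<in> S \<inter> {0<..y}"
    then show "cell_index a u \<noteq> cell_index a v"
      using cell_index_strict[OF assms(1) _ gap, of u v] by auto
  qed auto
  then have "card (S \<inter> {0<..y}) = card (cell_index a ` (S \<inter> {0<..y}))" by (simp add: card_image)
  also have "\<dots> \<le> card {k. k < m \<and> k < n \<and> card (S \<inter> cell a k) \<noteq> 0}"
  proof (intro card_mono)
    show "cell_index a ` (S \<inter> {0<..y}) \<subseteq> {k. k < m \<and> k < n \<and> card (S \<inter> cell a k) \<noteq> 0}"
    proof clarify
      fix x assume x: "x \<in> S" "x \<in> {0<..y}"
      then have "cell_index a x < m" using y assms(1) by (intro cell_index_less) auto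
      moreover have "x \<in> S \<inter> cell a (cell_index a x)" using cell_index[of a x] x assms(1) by auto
      ultimately show "cell_index a x < m \<and> cell_index a x < n \<and> card (S \<inter> cell a (cell_index a x)) \<noteq> 0"
        using y fin[OF bounded_cell] by (auto simp: card_eq_0_iff)
    qed
  qed auto
  finally show ?thesis by (simp add: tally_eq_card)
qed

section \<open>A single locally finite configuration: lattice against continuum\<close>

locale config =
  fixes al :: "(real \<times> real) set" and sr sk :: "real set" and t :: real
  assumes t: "0 < t"
    and fin_al: "\<And>B. bounded B \<Longrightarrow> finite (al \<inter> B)"
    and fin_sr: "\<And>B. bounded B \<Longrightarrow> finite (sr \<inter> B)"
    and fin_sk: "\<And>B. bounded B \<Longrightarrow> finite (sk \<inter> B)"
begin

lemma finite_al_hrect: "finite (al \<inter> hrect t z)"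
  by (rule fin_al) (auto simp: hrect_def intro: bounded_Times)

lemma hA_upper: "set xs \<subseteq> al \<inter> hrect t z \<Longrightarrow> incr_list xs \<Longrightarrow> length xs \<le> hA al t z"
  unfolding hA_def is_chain_def by (rule incr_list_Sup(1)[OF finite_al_hrect])

lemma hA_attained: "\<exists>xs. set xs \<subseteq> al \<inter> hrect t z \<and> incr_list xs \<and> length xs = hA al t z"
  unfolding hA_def is_chain_def by (rule incr_list_Sup(2)[OF finite_al_hrect])

lemma hrect_eq: "hrect t z = {max z 0<..t} \<times> {max (- z) 0<..t}"
  by (auto simp: hrect_def)

abbreviation H :: "real \<Rightarrow> nat" where "H z \<equiv> hN sr sk z + hA al t z"

lemma H_bounded:
  assumes "\<bar>z\<bar> \<le> t"
  shows "H z \<le> card (sr \<inter> {0<..t}) + card (sk \<inter> {0<..t}) + card (al \<inter> hrect t 0)"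
proof -
  obtain xs where xs: "set xs \<subseteq> al \<inter> hrect t z" "incr_list xs" "length xs = hA al t z"
    using hA_attained by blast
  have "hrect t z \<subseteq> hrect t 0" by (auto simp: hrect_eq)
  then have "hA al t z \<le> card (al \<inter> hrect t 0)"
    using incr_list_length_le_card[OF finite_al_hrect[of 0], of xs] xs by auto
  moreover have "hN sr sk z \<le> card (sr \<inter> {0<..t}) + card (sk \<inter> {0<..t})"
  proof -
    have "card (sr \<inter> {0<..z}) \<le> card (sr \<inter> {0<..t})" "card (sk \<inter> {0<..- z}) \<le> card (sk \<inter> {0<..t})"
      using assms by (auto intro!: card_mono fin_sr fin_sk)
    then show ?thesis by (auto simp: hN_def)
  qed
  ultimately show ?thesis by linarith
qed

lemma hL_facts:
  shows hL_ge: "\<And>z. \<bar>z\<bar> \<le> t \<Longrightarrow> H z \<le> hL al sr sk t"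
    and hL_attained: "\<exists>z. \<bar>z\<bar> \<le> t \<and> H z = hL al sr sk t"
proof -
  let ?S = "{H z | z. - t \<le> z \<and> z \<le> t}"
  have "?S \<subseteq> {..card (sr \<inter> {0<..t}) + card (sk \<inter> {0<..t}) + card (al \<inter> hrect t 0)}"
    using H_bounded by (auto simp: abs_le_iff)
  then have fin: "finite ?S" using finite_subset by blast
  have ne: "?S \<noteq> {}" using t by (auto intro!: exI[of _ 0])
  have Sup: "hL al sr sk t = Max ?S" unfolding hL_def using fin ne by (simp add: cSup_eq_Max)
  show "H z \<le> hL al sr sk t" if "\<bar>z\<bar> \<le> t" for z
    unfolding Sup using fin that by (intro Max_ge) auto
  show "\<exists>z. \<bar>z\<bar> \<le> t \<and> H z = hL al sr sk t"
    using Max_in[OF fin ne] unfolding Sup by (auto simp: abs_le_iff minus_le_iff)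
qed

text \<open>The supremum need not be a maximiser itself, since a chain may lose a point exactly
  there. Hence the second part offers only maximisers beyond any smaller u.\<close>

lemma hZ_facts:
  shows hZ_ge: "\<And>z. \<bar>z\<bar> \<le> t \<Longrightarrow> H z = hL al sr sk t \<Longrightarrow> z \<le> hZ al sr sk t"
    and hZ_less: "\<And>u. u < hZ al sr sk t \<Longrightarrow> \<exists>z. u < z \<and> \<bar>z\<bar> \<le> t \<and> H z = hL al sr sk t"
proof -
  let ?S = "{z. - t \<le> z \<and> z \<le> t \<and> H z = hL al sr sk t}"
  have bdd: "bdd_above ?S" by (rule bdd_aboveI[of _ t]) auto
  have ne: "?S \<noteq> {}" using hL_attained by (auto simp: abs_le_iff minus_le_iff)
  show "z \<le> hZ al sr sk t" if "\<bar>z\<bar> \<le> t" "H z = hL al sr sk t" for z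
    unfolding hZ_def using that by (intro cSup_upper bdd) auto
  show "\<exists>z. u < z \<and> \<bar>z\<bar> \<le> t \<and> H z = hL al sr sk t" if "u < hZ al sr sk t" for u
    using less_cSupD[OF ne that[unfolded hZ_def]] by (auto simp: abs_le_iff)
qed

lemma boundary_count_grid:
  "boundary_count (grid a b n al sr sk) k = (if 0 \<le> k
      then tally (\<lambda>i. i < n \<and> card (sr \<inter> cell a i) \<noteq> 0) (nat k)
      else tally (\<lambda>i. i < n \<and> card (sk \<inter> cell a i) \<noteq> 0) (nat (- k)))"
  by (simp add: boundary_count_def grid_def)

text \<open>A lattice path yields a continuous one leaving at k b, clipped to [-t, t]: its bulk
  cells lie beyond k b, and its boundary cells end at k a, which is no further out than k b. Since n
  b may exceed t, \<open>extra\<close> excludes points in the overshoot.\<close>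

lemma grid_le:
  assumes ab: "0 < a" "a \<le> b" and n: "real n * a = t" and k: "\<bar>k\<bar> \<le> int n"
    and extra: "al \<inter> {0<..real n * b} \<times> {0<..real n * b} \<subseteq> {..t} \<times> {..t}"
  shows "boundary_count (grid a b n al sr sk) k + bulk_length (grid a b n al sr sk) n k \<le> H (max (- t) (min t (k * b)))"
proof -
  let ?g = "grid a b n al sr sk"
  define z where "z = max (- t) (min t (k * b))"
  have le: "real m * a \<le> min t (real m * b)" if "m \<le> n" for m
    using that ab n mult_right_mono[of "real m" "real n" a] by (auto intro: mult_left_mono)
  have b: "0 < b" using ab by simp
  have N: "boundary_count ?g k \<le> hN sr sk z"
  proof (cases "0 \<le> k")
    case True
    have "0 \<le> real (nat k) * b" using b by simp
    then have z: "z = min t (real (nat k) * b)" "0 \<le> z" using t True by (auto simp: z_def)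
    have "tally (\<lambda>i. i < n \<and> card (sr \<inter> cell a i) \<noteq> 0) (nat k) \<le> card (sr \<inter> {0<..z})"
      using le[of "nat k"] k True unfolding z by (intro tally_cells_le ab fin_sr) auto
    then show ?thesis using True z(2) by (simp add: boundary_count_grid hN_def)
  next
    case False
    have kb: "0 < real (nat (- k)) * b" "k * b = - (real (nat (- k)) * b)" using False b by (auto simp: mult_less_0_iff)
    then have z: "- z = min t (real (nat (- k)) * b)" using t unfolding z_def by linarith
    then have "z < 0" using kb t by linarith
    have "tally (\<lambda>i. i < n \<and> card (sk \<inter> cell a i) \<noteq> 0) (nat (- k)) \<le> card (sk \<inter> {0<..- z})"
      using le[of "nat (- k)"] k False unfolding z by (intro tally_cells_le ab fin_sk) auto
    then show ?thesis using False \<open>z < 0\<close> by (simp add: boundary_count_grid hN_def)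
  qed
  have x0: "max z 0 = min t (real (nat k) * b)" and y0: "max (- z) 0 = min t (real (nat (- k)) * b)"
  proof -
    have "k * b = real (nat k) * b - real (nat (- k)) * b" by (cases "0 \<le> k") auto
    moreover have "real (nat k) * b = 0 \<or> real (nat (- k)) * b = 0" by (cases "0 \<le> k") auto
    moreover have "0 \<le> real (nat k) * b" "0 \<le> real (nat (- k)) * b" using b by auto
    ultimately show "max z 0 = min t (real (nat k) * b)" "max (- z) 0 = min t (real (nat (- k)) * b)"
      using t unfolding z_def by linarith+
  qed
  obtain xs where xs: "set xs \<subseteq> cells ?g k n n" "incr_list xs" "length xs = bulk_length ?g n k"
    using bulk_length_attained by blast
  \<comment> \<open>One point is chosen in each cell of the chain. Cells of distinct index are
    disjoint and ordered, so strictly increasing cells give strictly increasing points.\<close>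
  have "\<forall>c\<in>set xs. \<exists>p. p \<in> al \<inter> cell b (fst c) \<times> cell b (snd c)"
  proof
    fix c assume "c \<in> set xs"
    then have "card (al \<inter> cell b (fst c) \<times> cell b (snd c)) \<noteq> 0" using xs(1) by (auto simp: cells_def grid_def)
    then show "\<exists>p. p \<in> al \<inter> cell b (fst c) \<times> cell b (snd c)" by (metis card.empty ex_in_conv)
  qed
  from bchoice[OF this] obtain pt
    where pt: "\<And>c. c \<in> set xs \<Longrightarrow> pt c \<in> al \<inter> cell b (fst c) \<times> cell b (snd c)" by blast
  have step: "real (Suc i) * b \<le> real j * b" if "i < j" for i j
    using that ab by (intro mult_right_mono) auto
  have "incr_list (map pt xs)"
    unfolding sorted_wrt_map
  proof (rule sorted_wrt_mono_rel[OF _ xs(2)])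
    fix c c' assume "c \<in> set xs" "c' \<in> set xs" "fst c < fst c' \<and> snd c < snd c'"
    then show "fst (pt c) < fst (pt c') \<and> snd (pt c) < snd (pt c')"
      using pt[of c] pt[of c'] step[of "fst c" "fst c'"] step[of "snd c" "snd c'"]
      by (auto simp: cell_def mem_Times_iff simp del: of_nat_Suc)
  qed
  moreover have "set (map pt xs) \<subseteq> al \<inter> hrect t z"
  proof
    fix p assume "p \<in> set (map pt xs)"
    then obtain c where c: "c \<in> set xs" "p = pt c" by auto
    obtain i j where ij: "c = (i, j)" by (cases c)
    have m: "nat k \<le> i" "i < n" "nat (- k) \<le> j" "j < n" using c ij xs(1) by (auto simp: cells_def)
    have p: "p \<in> al" "fst p \<in> cell b i" "snd p \<in> cell b j" using pt[OF c(1)] c ij by auto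
    have lo: "real (nat k) * b \<le> real i * b" "real (nat (- k)) * b \<le> real j * b" "0 \<le> real i * b" "0 \<le> real j * b"
      using m ab by (auto intro!: mult_right_mono)
    have hi: "real (Suc i) * b \<le> real n * b" "real (Suc j) * b \<le> real n * b" using m step by auto
    have "p \<in> al \<inter> {0<..real n * b} \<times> {0<..real n * b}"
      using p lo hi by (auto simp: cell_def mem_Times_iff simp del: of_nat_Suc)
    then have "fst p \<le> t" "snd p \<le> t" using extra by (auto simp: mem_Times_iff)
    then show "p \<in> al \<inter> hrect t z"
      unfolding hrect_eq x0 y0 using p lo by (auto simp: cell_def mem_Times_iff)
  qed
  ultimately have "bulk_length ?g n k \<le> hA al t z" using hA_upper[of "map pt xs" z] xs(3) by simp
  then show ?thesis using N unfolding z_def by linarith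
qed

text \<open>On a fine mesh a continuous path survives discretisation: \<open>gap\<close> keeps
  distinct coordinates in distinct cells, and \<open>above\<close> keeps the chain beyond the
  rounded exit position despite the mismatch of a and b. C collects all coordinates
  concerned.\<close>

lemma grid_ge:
  assumes ab: "0 < a" "a \<le> b" and n: "real n * a = t" and z: "\<bar>z\<bar> \<le> t"
    and xs: "set xs \<subseteq> al \<inter> hrect t z" "incr_list xs"
    and gap: "\<And>u v. u \<in> C \<Longrightarrow> v \<in> C \<Longrightarrow> u < v \<Longrightarrow> u + b < v"
    and C: "fst ` set xs \<subseteq> C" "snd ` set xs \<subseteq> C" "sr \<inter> {0<..t} \<subseteq> C" "sk \<inter> {0<..t} \<subseteq> C"
    and above: "\<And>p. p \<in> set xs \<Longrightarrow> (max z 0 / a + 1) * b < fst p"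
       "\<And>p. p \<in> set xs \<Longrightarrow> (max (- z) 0 / a + 1) * b < snd p"
  shows "\<exists>k. \<bar>k\<bar> \<le> int n \<and> (0 \<le> z \<longrightarrow> 0 \<le> k \<and> z \<le> k * a) \<and>
    hN sr sk z + length xs \<le> boundary_count (grid a b n al sr sk) k + bulk_length (grid a b n al sr sk) n k"
proof -
  let ?g = "grid a b n al sr sk"
  \<comment> \<open>Rounding away from zero, so that the boundary cells up to k contain every
    boundary point that z counts.\<close>
  define k where "k = (if 0 \<le> z then \<lceil>z / a\<rceil> else - \<lceil>- z / a\<rceil>)"
  have ceil: "\<lceil>x / a\<rceil> \<le> int n" if "x \<le> t" for x
  proof -
    have "x / a \<le> real n" using that n ab by (simp add: pos_divide_le_eq)
    then show ?thesis by (simp add: ceiling_le_iff)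
  qed
  have ceil0: "0 \<le> \<lceil>x / a\<rceil>" if "0 \<le> x" for x using that ab by (simp add: le_ceiling_iff) (smt (verit) divide_nonneg_pos)
  have ceilx: "x \<le> of_int \<lceil>x / a\<rceil> * a" for x
    using le_of_int_ceiling[of "x / a"] by (simp only: pos_divide_le_eq[OF ab(1)])
  have k: "\<bar>k\<bar> \<le> int n" using ceil[of z] ceil[of "- z"] ceil0[of z] ceil0[of "- z"] z
    by (auto simp: k_def)
  have natk: "real (nat k) \<le> max z 0 / a + 1" "real (nat (- k)) \<le> max (- z) 0 / a + 1"
    using ceil0[of z] ceil0[of "- z"] by (auto simp: k_def) linarith+
  have gap': "u + a < v" if "u \<in> C" "v \<in> C" "u < v" for u v using gap[OF that] ab by linarith
  have N: "hN sr sk z \<le> boundary_count ?g k"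
  proof (cases "0 \<le> z")
    case True
    have "card (sr \<inter> {0<..z}) \<le> tally (\<lambda>i. i < n \<and> card (sr \<inter> cell a i) \<noteq> 0) (nat k)"
    proof (intro card_le_tally_cells ab fin_sr)
      have "k = \<lceil>z / a\<rceil>" "0 \<le> k" using True ceil0[of z] by (auto simp: k_def)
      then show "z \<le> real (nat k) * a" "nat k \<le> n" using ceilx[of z] k by (metis of_nat_nat of_int_of_nat_eq, linarith)
      show "u + a < v" if "u \<in> sr \<inter> {0<..z}" "v \<in> sr \<inter> {0<..z}" "u < v" for u v
        using that z C(3) by (intro gap') auto
    qed
    then show ?thesis using True ceil0[of z] by (auto simp: boundary_count_grid hN_def k_def)
  next
    case False
    have neg: "0 < \<lceil>- z / a\<rceil>" using False ab by (simp add: less_ceiling_iff divide_neg_pos)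
    have "card (sk \<inter> {0<..- z}) \<le> tally (\<lambda>i. i < n \<and> card (sk \<inter> cell a i) \<noteq> 0) (nat (- k))"
    proof (intro card_le_tally_cells ab fin_sk)
      have "- k = \<lceil>- z / a\<rceil>" "0 \<le> - k" using False neg by (auto simp: k_def)
      then show "- z \<le> real (nat (- k)) * a" "nat (- k) \<le> n" using ceilx[of "- z"] k by (metis of_nat_nat of_int_of_nat_eq, linarith)
      show "u + a < v" if "u \<in> sk \<inter> {0<..- z}" "v \<in> sk \<inter> {0<..- z}" "u < v" for u v
        using that z C(4) by (intro gap') auto
    qed
    then show ?thesis using False neg by (auto simp: boundary_count_grid hN_def k_def)
  qed
  have b: "0 < b" using ab by simp
  define ix where "ix p = (cell_index b (fst p), cell_index b (snd p))" for p
  have pos: "0 < fst p" "0 < snd p" "fst p \<le> real n * b" "snd p \<le> real n * b" if "p \<in> set xs" for p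
  proof -
    have "t \<le> real n * b" using n ab by (metis mult_left_mono of_nat_0_le_iff)
    then show "0 < fst p" "0 < snd p" "fst p \<le> real n * b" "snd p \<le> real n * b"
      using xs(1) that by (auto simp: hrect_eq)
  qed
  have "incr_list (map ix xs)"
    unfolding sorted_wrt_map
  proof (rule sorted_wrt_mono_rel[OF _ xs(2)])
    fix p q assume pq: "p \<in> set xs" "q \<in> set xs" "fst p < fst q \<and> snd p < snd q"
    have "fst p + b < fst q" "snd p + b < snd q" using pq C(1,2) by (auto intro!: gap)
    then show "fst (ix p) < fst (ix q) \<and> snd (ix p) < snd (ix q)"
      using pos[OF pq(1)] b by (auto simp: ix_def intro!: cell_index_strict)
  qed
  moreover have "set (map ix xs) \<subseteq> cells ?g k n n"
  proof
    fix c assume "c \<in> set (map ix xs)"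
    then obtain p where p: "p \<in> set xs" "c = ix p" by auto
    have lt: "cell_index b (fst p) < n" "cell_index b (snd p) < n"
      using pos[OF p(1)] b by (auto intro!: cell_index_less)
    have "p \<in> al \<inter> cell b (cell_index b (fst p)) \<times> cell b (cell_index b (snd p))"
      using xs(1) p(1) cell_index[OF b] pos[OF p(1)] by (auto simp: mem_Times_iff)
    then have "card (al \<inter> cell b (cell_index b (fst p)) \<times> cell b (cell_index b (snd p))) \<noteq> 0"
      using fin_al[OF bounded_Times[OF bounded_cell bounded_cell]] by (auto simp: card_eq_0_iff)
    moreover have "real (nat k) * b \<le> (max z 0 / a + 1) * b" "real (nat (- k)) * b \<le> (max (- z) 0 / a + 1) * b"
      using natk b by (auto intro!: mult_right_mono)
    then have "real (nat k) * b < fst p" "real (nat (- k)) * b < snd p"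
      using above[OF p(1)] by linarith+
    then have "nat k \<le> cell_index b (fst p)" "nat (- k) \<le> cell_index b (snd p)"
      using pos[OF p(1)] b by (auto intro!: cell_index_ge)
    ultimately show "c \<in> cells ?g k n n" using lt by (simp add: p(2) ix_def cells_def grid_def)
  qed
  ultimately have "length xs \<le> bulk_length ?g n k" using bulk_length_upper[of "map ix xs" ?g k n] by simp
  then show ?thesis using N k ceilx[of z] ceil0[of z] by (intro exI[of _ k]) (auto simp: k_def)
qed

section \<open>Convergence along ever finer meshes\<close>

context
  fixes b :: "nat \<Rightarrow> real"
  assumes b_ge: "\<forall>\<^sub>F n in sequentially. t / real n \<le> b n"
    and b_lim: "(\<lambda>n. real n * b n) \<longlonglongrightarrow> t"
begin

abbreviation G :: "nat \<Rightarrow> site \<Rightarrow> bool" where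
  "G n \<equiv> grid (t / real n) (b n) n al sr sk"

lemma b_tendsto_0: "b \<longlonglongrightarrow> 0"
proof -
  have "(\<lambda>n. real n * b n * (1 / real n)) \<longlonglongrightarrow> t * 0"
    by (intro tendsto_mult b_lim lim_1_over_n)
  moreover have "\<forall>\<^sub>F n in sequentially. real n * b n * (1 / real n) = b n"
    using eventually_gt_at_top[of 0] by eventually_elim simp
  ultimately show ?thesis by (simp add: filterlim_cong)
qed

text \<open>Only finitely many points lie in the square of side t + 1, and each of their coordinates
  exceeding t eventually exceeds n b as well, since n b tends to t.\<close>

lemma eventually_no_extra:
  "\<forall>\<^sub>F n in sequentially. al \<inter> {0<..real n * b n} \<times> {0<..real n * b n} \<subseteq> {..t} \<times> {..t}"
proof -
  define F where "F = al \<inter> {0<..t + 1} \<times> {0<..t + 1}"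
  have "finite F" unfolding F_def by (intro fin_al bounded_Times) auto
  moreover have "\<forall>\<^sub>F n in sequentially. c \<le> t \<or> real n * b n < c" for c
    using order_tendstoD(2)[OF b_lim, of c] by (cases "c \<le> t") auto
  then have "\<forall>\<^sub>F n in sequentially. (fst p \<le> t \<or> real n * b n < fst p) \<and> (snd p \<le> t \<or> real n * b n < snd p)" for p
    by (intro eventually_conj)
  ultimately have "\<forall>\<^sub>F n in sequentially. \<forall>p\<in>F. (fst p \<le> t \<or> real n * b n < fst p) \<and> (snd p \<le> t \<or> real n * b n < snd p)"
    by (intro eventually_ball_finite) auto
  moreover have "\<forall>\<^sub>F n in sequentially. real n * b n < t + 1" using order_tendstoD(2)[OF b_lim, of "t + 1"] by simp
  ultimately show ?thesis
  proof eventually_elim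
    case (elim n)
    show ?case
    proof
      fix p assume p: "p \<in> al \<inter> {0<..real n * b n} \<times> {0<..real n * b n}"
      then have "p \<in> F" using elim(2) by (auto simp: F_def)
      then show "p \<in> {..t} \<times> {..t}" using p elim(1) by (auto simp: mem_Times_iff)
    qed
  qed
qed

text \<open>One optimal chain and the boundary points up to t involve finitely many coordinates, so
  the conditions of \<open>grid_ge\<close> hold for all large n simultaneously.\<close>

lemma eventually_grid_ge:
  assumes z: "\<bar>z\<bar> \<le> t"
  shows "\<forall>\<^sub>F n in sequentially. \<exists>k. \<bar>k\<bar> \<le> int n \<and> (0 \<le> z \<longrightarrow> 0 \<le> k \<and> z \<le> k * (t / real n)) \<and>
    H z \<le> boundary_count (G n) k + bulk_length (G n) n k"
proof -
  obtain xs where xs: "set xs \<subseteq> al \<inter> hrect t z" "incr_list xs" "length xs = hA al t z"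
    using hA_attained by blast
  define C where "C = fst ` set xs \<union> snd ` set xs \<union> (sr \<inter> {0<..t}) \<union> (sk \<inter> {0<..t})"
  have "finite C" unfolding C_def by (auto intro!: fin_sr fin_sk)
  moreover have "\<forall>\<^sub>F n in sequentially. u < v \<longrightarrow> u + b n < v" for u v
  proof (cases "u < v")
    case True
    then show ?thesis using order_tendstoD(2)[OF b_tendsto_0, of "v - u"]
      by (auto elim!: eventually_mono)
  qed simp
  ultimately have gap: "\<forall>\<^sub>F n in sequentially. \<forall>u\<in>C. \<forall>v\<in>C. u < v \<longrightarrow> u + b n < v"
    by (intro eventually_ball_finite ballI)
  have above: "\<forall>\<^sub>F n in sequentially. (x0 / (t / real n) + 1) * b n < x" if "x0 < x" for x x0
  proof -
    have "(\<lambda>n. x0 / t * (real n * b n) + b n) \<longlonglongrightarrow> x0 / t * t + 0"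
      by (intro tendsto_intros b_lim b_tendsto_0)
    then have "\<forall>\<^sub>F n in sequentially. x0 / t * (real n * b n) + b n < x"
      using t that by (intro order_tendstoD(2)) auto
    then show ?thesis by eventually_elim (simp add: algebra_simps)
  qed
  have "\<forall>\<^sub>F n in sequentially. \<forall>p\<in>set xs. (max z 0 / (t / real n) + 1) * b n < fst p"
    "\<forall>\<^sub>F n in sequentially. \<forall>p\<in>set xs. (max (- z) 0 / (t / real n) + 1) * b n < snd p"
    using xs(1) by (intro eventually_ball_finite ballI above; auto simp: hrect_eq)+
  with gap b_ge eventually_gt_at_top[of 0] show ?thesis
  proof eventually_elim
    case (elim n)
    then show ?case
      unfolding xs(3)[symmetric] using t z xs(1,2)
      by (intro grid_ge[where C = C]) (auto simp: C_def)
  qed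
qed

lemma eventually_lpp_eq_hL: "\<forall>\<^sub>F n in sequentially. lpp (G n) n n = hL al sr sk t"
proof -
  obtain z where z: "\<bar>z\<bar> \<le> t" "H z = hL al sr sk t" using hL_attained by blast
  show ?thesis
    using eventually_no_extra b_ge eventually_gt_at_top[of 0] eventually_grid_ge[OF z(1)]
  proof eventually_elim
    case (elim n)
    obtain k where k: "\<bar>k\<bar> \<le> int n" "boundary_count (G n) k + bulk_length (G n) n k = lpp (G n) n n"
      using lpp_attained by blast
    have "lpp (G n) n n \<le> H (max (- t) (min t (k * b n)))"
      unfolding k(2)[symmetric] using elim t k by (intro grid_le) auto
    also have "\<dots> \<le> hL al sr sk t" using t by (intro hL_ge) auto
    finally have "lpp (G n) n n \<le> hL al sr sk t" .
    moreover have "hL al sr sk t \<le> lpp (G n) n n"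
      using elim(4) lpp_ge[of _ n "G n"] z(2) by (metis order_trans)
    ultimately show ?case by simp
  qed
qed

text \<open>Once the maxima agree, \<open>grid_le\<close> makes the clipped point k b a maximiser of
  the continuous problem, and k a lies below it. The maximum with 0 covers exit index 0.\<close>

lemma eventually_exit_index_le: "\<forall>\<^sub>F n in sequentially. exit_index (G n) n * (t / real n) \<le> max (hZ al sr sk t) 0"
  using eventually_no_extra b_ge eventually_gt_at_top[of 0] eventually_lpp_eq_hL
proof eventually_elim
  case (elim n)
  define k where "k = exit_index (G n) n"
  show ?case
  proof (cases "k = 0")
    case False
    have k: "k \<le> n" "boundary_count (G n) (int k) + bulk_length (G n) n (int k) = hL al sr sk t"
      using exit_index_le[of "G n" n] exit_index_maximizer[of "G n" n] False elim(4) by (auto simp: k_def)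
    have "hL al sr sk t \<le> H (max (- t) (min t (int k * b n)))"
      unfolding k(2)[symmetric] using elim t k by (intro grid_le) auto
    then have "H (max (- t) (min t (int k * b n))) = hL al sr sk t"
      using t by (intro antisym hL_ge) auto
    then have "max (- t) (min t (int k * b n)) \<le> hZ al sr sk t" using t by (intro hZ_ge) auto
    moreover have "k * (t / real n) \<le> t" using k(1) elim(3) t by (simp add: field_simps)
    moreover have "k * (t / real n) \<le> k * b n" using elim(2) by (intro mult_left_mono) auto
    ultimately show ?thesis unfolding k_def[symmetric] of_int_of_nat_eq by linarith
  qed (simp add: k_def)
qed

lemma eventually_exit_index_ge:
  assumes "0 \<le> u" "u < hZ al sr sk t"
  shows "\<forall>\<^sub>F n in sequentially. u \<le> exit_index (G n) n * (t / real n)"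
proof -
  obtain z where z: "u < z" "\<bar>z\<bar> \<le> t" "H z = hL al sr sk t" using hZ_less[OF assms(2)] by blast
  show ?thesis
    using eventually_grid_ge[OF z(2)] eventually_lpp_eq_hL
  proof eventually_elim
    case (elim n)
    obtain k where k: "\<bar>k\<bar> \<le> int n" "0 \<le> k" "z \<le> k * (t / real n)" "H z \<le> boundary_count (G n) k + bulk_length (G n) n k"
      using elim(1) z assms(1) by auto
    then have "boundary_count (G n) k + bulk_length (G n) n k = lpp (G n) n n"
      using lpp_ge[OF k(1), of "G n"] z(3) elim(2) by linarith
    then have "nat k \<le> exit_index (G n) n" using k by (intro exit_index_ge) auto
    then have "real_of_int k * (t / real n) \<le> real (exit_index (G n) n) * (t / real n)"
      using t k(2) by (intro mult_right_mono) (linarith, simp)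
    then show ?case using k(3) z(1) by linarith
  qed
qed

end

end

section \<open>Law of the discretised model\<close>

lemma cell_disjoint:
  assumes "0 < a" "k \<noteq> l"
  shows "cell a k \<inter> cell a l = {}"
proof -
  have *: "cell a k \<inter> cell a l = {}" if "k < l" for k l
  proof -
    have "real (Suc k) * a \<le> real l * a" using that assms(1) by (intro mult_right_mono) auto
    then show ?thesis by (auto simp: cell_def simp del: of_nat_Suc)
  qed
  show ?thesis using *[of k l] *[of l k] assms(2) by (cases "k < l") auto
qed

lemma cell_subset_pos: "0 < a \<Longrightarrow> cell a k \<subseteq> {0<..}"
  by (auto simp: cell_def intro: le_less_trans[rotated])

lemma sets_cell [simp]: "cell a k \<in> sets borel"
  by (simp add: cell_def)

lemma sets_cell_Times [simp]: "cell a k \<times> cell b l \<in> sets borel"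
proof -
  have "cell a k \<times> cell b l \<in> sets (borel \<Otimes>\<^sub>M borel)" by (intro pair_measureI) auto
  then show ?thesis unfolding borel_prod .
qed

lemma emeasure_cell: "0 < a \<Longrightarrow> emeasure lborel (cell a k) = ennreal a"
  by (simp add: cell_def algebra_simps)

lemma measure_cell [simp]: "0 < a \<Longrightarrow> measure lborel (cell a k) = a"
  by (simp add: measure_def emeasure_cell)

lemma measure_cell_Times [simp]:
  assumes "0 < b"
  shows "measure lborel (cell b k \<times> cell b l) = b\<^sup>2"
proof -
  have "emeasure (lborel \<Otimes>\<^sub>M lborel) (cell b k \<times> cell b l) = emeasure lborel (cell b k) * emeasure lborel (cell b l)"
    by (intro lborel.emeasure_pair_measure_Times) auto
  then show ?thesis using assms
    by (simp add: lborel_prod measure_def emeasure_cell power2_eq_square ennreal_mult[symmetric])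
qed

lemma finite_site_configs: "finite {\<phi> :: site \<Rightarrow> bool. \<forall>x. x \<notin> sites n \<longrightarrow> \<not> \<phi> x}"
proof -
  have "{\<phi> :: site \<Rightarrow> bool. \<forall>x. x \<notin> sites n \<longrightarrow> \<not> \<phi> x} = PiE_dflt (sites n) False (\<lambda>_. UNIV)"
    by (auto simp: PiE_dflt_def)
  then show ?thesis by (simp add: finite_PiE_dflt)
qed

context
  fixes P :: "'a measure" and alpha :: "'a \<Rightarrow> (real \<times> real) set" and src snk :: "'a \<Rightarrow> real set"
    and a b :: real and n :: nat
  assumes model: "hammersley_model P alpha src snk" and ab: "0 < a" "0 < b" and n: "0 < n"
begin

interpretation prob_space P
  using model by (simp add: hammersley_model_def)

abbreviation grid_at :: "'a \<Rightarrow> site \<Rightarrow> bool" where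
  "grid_at \<omega> \<equiv> grid a b n (alpha \<omega>) (src \<omega>) (snk \<omega>)"

abbreviation grid_law :: "(site \<Rightarrow> bool) pmf" where
  "grid_law \<equiv> law n (1 - exp (- a)) (1 - exp (- a)) (1 - exp (- (b\<^sup>2)))"

text \<open>A lattice configuration is an event about the counts in finitely many disjoint cells;
  these are independent, and a cell is empty with the Poisson probability exp (- rate).\<close>

lemma grid_pointwise:
  assumes \<phi>: "\<And>x. x \<notin> sites n \<Longrightarrow> \<not> \<phi> x"
  shows "{\<omega> \<in> space P. grid_at \<omega> = \<phi>} \<in> events"
    and "prob {\<omega> \<in> space P. grid_at \<omega> = \<phi>} = pmf grid_law \<phi>"
proof -
  define A :: "nat \<Rightarrow> (real \<times> real) set" where "A i = cell b (i div n) \<times> cell b (i mod n)" for i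
  \<comment> \<open>The model asks for families of one common length. The bulk dictates n * n, so
    the boundary families are padded with empty sets.\<close>
  define S :: "nat \<Rightarrow> real set" where "S i = (if i < n then cell a i else {})" for i
  define cnt :: "nat + nat + nat \<Rightarrow> 'a \<Rightarrow> nat" where "cnt = (\<lambda>j \<omega>. case j of
                         Inl i \<Rightarrow> card (alpha \<omega> \<inter> A i)
                       | Inr (Inl i) \<Rightarrow> card (src \<omega> \<inter> S i)
                       | Inr (Inr i) \<Rightarrow> card (snk \<omega> \<inter> S i))"
  define rt :: "nat + nat + nat \<Rightarrow> real" where "rt = (\<lambda>j. case j of
                         Inl i \<Rightarrow> measure lborel (A i)
                       | Inr (Inl i) \<Rightarrow> measure lborel (S i)
                       | Inr (Inr i) \<Rightarrow> measure lborel (S i))"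
  define J :: "(nat + nat + nat) set" where "J = {..<n * n} <+> ({..<n * n} <+> {..<n * n})"
  have "disjoint_family_on A {..<n * n}"
    unfolding disjoint_family_on_def
  proof (intro ballI impI)
    fix i j :: nat assume "i \<noteq> j"
    then have "i div n \<noteq> j div n \<or> i mod n \<noteq> j mod n" by (metis div_mult_mod_eq)
    then show "A i \<inter> A j = {}" using cell_disjoint[OF ab(2)] by (auto simp: A_def)
  qed
  moreover have "disjoint_family_on S {..<n * n}"
    using cell_disjoint[OF ab(1)] by (auto simp: disjoint_family_on_def S_def)
  moreover have "A i \<in> sets borel \<and> bounded (A i) \<and> A i \<subseteq> {0<..} \<times> {0<..}" for i
    using cell_subset_pos[OF ab(2)] by (auto simp: A_def intro: bounded_Times)
  moreover have "S i \<in> sets borel \<and> bounded (S i) \<and> S i \<subseteq> {0<..}" for i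
    using cell_subset_pos[OF ab(1)] by (auto simp: S_def)
  ultimately have "indep_vars (\<lambda>_. count_space UNIV) cnt J \<and> (\<forall>j\<in>J. poisson_count P (cnt j) (rt j))"
    using model[unfolded hammersley_model_def, THEN conjunct2, THEN conjunct2, rule_format, of "n * n" A S S]
    unfolding cnt_def rt_def J_def Let_def by blast
  then have ind: "indep_vars (\<lambda>_. count_space UNIV) cnt J" and poi: "\<And>j. j \<in> J \<Longrightarrow> poisson_count P (cnt j) (rt j)"
    by auto
  define e where "e x = (case x of Src k \<Rightarrow> Inr (Inl k) | Snk k \<Rightarrow> Inr (Inr k) | Bulk k l \<Rightarrow> Inl (k * n + l))" for x
  have idx: "k * n + l < n * n" if "k < n" "l < n" for k l
  proof -
    have "k * n + l < Suc k * n" using that by simp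
    also have "\<dots> \<le> n * n" using that by (intro mult_right_mono) auto
    finally show ?thesis .
  qed
  have nn: "k < n * n" if "k < n" for k using idx[of 0 k] that by simp
  have eJ: "e ` sites n \<subseteq> J"
    using idx nn by (auto simp: sites_def J_def e_def)
  have inj: "inj_on e (sites n)"
  proof (rule inj_onI)
    fix x y assume xy: "x \<in> sites n" "y \<in> sites n" "e x = e y"
    have digits: "k = k' \<and> l = l'" if "k * n + l = k' * n + l'" "l < n" "l' < n" for k l k' l'
    proof -
      have "(i * n + j) div n = i \<and> (i * n + j) mod n = j" if "j < n" for i j using that by simp
      then show ?thesis using that by metis
    qed
    show "x = y" using xy by (cases x; cases y) (auto simp: e_def dest: digits)
  qed
  \<comment> \<open>This holds for every outcome, even without local finiteness, because
    \<open>grid\<close> tests the same \<open>card\<close> that the model counts.\<close>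
  have grid_cnt: "grid_at \<omega> x \<longleftrightarrow> cnt (e x) \<omega> \<noteq> 0" if "x \<in> sites n" for x \<omega>
    using that by (cases x) (auto simp: grid_def cnt_def e_def A_def S_def)
  have rt: "rt (e x) = (case x of Bulk k l \<Rightarrow> b\<^sup>2 | _ \<Rightarrow> a)" if "x \<in> sites n" for x
    using that ab by (cases x) (auto simp: rt_def e_def A_def S_def)
  define B where "B j = (if \<phi> (the_inv_into (sites n) e j) then - {0} else {0 :: nat})" for j
  have B: "B (e x) = (if \<phi> x then - {0} else {0})" if "x \<in> sites n" for x
    using that by (simp add: B_def the_inv_into_f_f[OF inj])
  have meas: "cnt j -` D \<inter> space P \<in> events" if "j \<in> J" for j D
    using poi[OF that] by (intro measurable_sets[of _ P "count_space UNIV"]) (auto simp: poisson_count_def)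
  have ne: "sites n \<noteq> {}" using n by (auto simp: sites_def)
  have ev: "{\<omega> \<in> space P. grid_at \<omega> = \<phi>} = (\<Inter>j\<in>e ` sites n. cnt j -` B j \<inter> space P)"
  proof -
    have "grid_at \<omega> = \<phi> \<longleftrightarrow> (\<forall>x\<in>sites n. cnt (e x) \<omega> \<in> B (e x))" for \<omega>
    proof -
      have "grid_at \<omega> = \<phi> \<longleftrightarrow> (\<forall>x\<in>sites n. grid_at \<omega> x = \<phi> x)"
        using \<phi> by (auto simp: fun_eq_iff grid_def)
      also have "\<dots> \<longleftrightarrow> (\<forall>x\<in>sites n. cnt (e x) \<omega> \<in> B (e x))"
        by (intro ball_cong refl) (simp add: grid_cnt B)
      finally show ?thesis .
    qed
    then show ?thesis using ne by auto
  qed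
  show "{\<omega> \<in> space P. grid_at \<omega> = \<phi>} \<in> events"
    unfolding ev using meas eJ ne by (intro sets.finite_INT) auto
  have zero: "prob (cnt j -` {0} \<inter> space P) = exp (- rt j)" if "j \<in> J" for j
  proof -
    have "cnt j -` {0} \<inter> space P = {\<omega> \<in> space P. cnt j \<omega> = 0}" by auto
    then show ?thesis using poi[OF that] by (simp add: poisson_count_def)
  qed
  have nonzero: "prob (cnt j -` (- {0}) \<inter> space P) = 1 - exp (- rt j)" if "j \<in> J" for j
  proof -
    have "cnt j -` (- {0}) \<inter> space P = space P - (cnt j -` {0} \<inter> space P)" by auto
    then show ?thesis using prob_compl[OF meas[OF that, of "{0}"]] zero[OF that] by simp
  qed
  have site: "prob (cnt (e x) -` B (e x) \<inter> space P) =
      pmf (bernoulli_pmf (rate (1 - exp (- a)) (1 - exp (- a)) (1 - exp (- (b\<^sup>2))) x)) (\<phi> x)"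
    if "x \<in> sites n" for x
  proof -
    have "e x \<in> J" using that eJ by blast
    then have "prob (cnt (e x) -` B (e x) \<inter> space P) = (if \<phi> x then 1 - exp (- rt (e x)) else exp (- rt (e x)))"
      using zero nonzero that by (simp add: B)
    then show ?thesis using that ab by (cases x) (auto simp: rt)
  qed
  have "prob {\<omega> \<in> space P. grid_at \<omega> = \<phi>} = (\<Prod>j\<in>e ` sites n. prob (cnt j -` B j \<inter> space P))"
    unfolding ev using ne eJ by (intro indep_varsD[OF ind]) auto
  also have "\<dots> = (\<Prod>x\<in>sites n. prob (cnt (e x) -` B (e x) \<inter> space P))"
    using inj by (simp add: prod.reindex)
  also have "\<dots> = pmf grid_law \<phi>"
    unfolding law_def using \<phi> by (subst pmf_Pi') (auto simp: site intro!: prod.cong)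
  finally show "prob {\<omega> \<in> space P. grid_at \<omega> = \<phi>} = pmf grid_law \<phi>" .
qed

text \<open>The grid takes finitely many values, so the point masses settle both measurability and
  the law.\<close>

lemma
  shows measurable_grid: "grid_at \<in> P \<rightarrow>\<^sub>M count_space UNIV"
    and distr_grid: "distr P (count_space UNIV) grid_at = measure_pmf grid_law"
proof -
  let ?R = "{\<phi> :: site \<Rightarrow> bool. \<forall>x. x \<notin> sites n \<longrightarrow> \<not> \<phi> x}"
  note fin = finite_site_configs[of n]
  have vim: "grid_at -` \<Phi> \<inter> space P = (\<Union>\<phi>\<in>\<Phi> \<inter> ?R. {\<omega> \<in> space P. grid_at \<omega> = \<phi>})" for \<Phi>
    by (auto simp: grid_def)
  have ev: "grid_at -` \<Phi> \<inter> space P \<in> events" for \<Phi>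
    unfolding vim using fin grid_pointwise(1) by (intro sets.finite_UN) auto
  then show m: "grid_at \<in> P \<rightarrow>\<^sub>M count_space UNIV" by (intro measurableI) auto
  show "distr P (count_space UNIV) grid_at = measure_pmf grid_law"
  proof (rule measure_eqI)
    fix \<Phi> :: "(site \<Rightarrow> bool) set"
    have "prob (grid_at -` \<Phi> \<inter> space P) = (\<Sum>\<phi>\<in>\<Phi> \<inter> ?R. prob {\<omega> \<in> space P. grid_at \<omega> = \<phi>})"
      unfolding vim using fin grid_pointwise(1)
      by (intro finite_measure_finite_Union) (auto simp: disjoint_family_on_def)
    also have "\<dots> = (\<Sum>\<phi>\<in>\<Phi> \<inter> ?R. pmf grid_law \<phi>)"
      using grid_pointwise(2) by (intro sum.cong) auto
    also have "\<dots> = measure_pmf.prob grid_law (\<Phi> \<inter> ?R)"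
      using fin by (intro measure_measure_pmf_finite[symmetric]) auto
    also have "\<dots> = measure_pmf.prob grid_law \<Phi>"
      by (intro measure_prob_cong_0) (auto simp: law_def pmf_Pi_outside)
    finally show "emeasure (distr P (count_space UNIV) grid_at) \<Phi> = emeasure (measure_pmf grid_law) \<Phi>"
      by (simp add: emeasure_distr[OF m] emeasure_eq_measure measure_pmf.emeasure_eq_measure)
  qed simp
qed

end

section \<open>Passage to the limit\<close>

text \<open>Chosen so that a bulk cell is occupied with probability exactly the square of the source odds.\<close>

definition bulk_side :: "real \<Rightarrow> nat \<Rightarrow> real" where
  "bulk_side t n = sqrt (- ln (1 - (exp (t / real n) - 1)\<^sup>2))"

lemma bulk_side_lim: "0 < t \<Longrightarrow> (\<lambda>n. real n * bulk_side t n) \<longlonglongrightarrow> t"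
  unfolding bulk_side_def by real_asymp

lemma step_lim: "0 < t \<Longrightarrow> (\<lambda>n. exp (t / real n) - 1) \<longlonglongrightarrow> 0"
  by real_asymp

text \<open>s is the odds of an occupied boundary cell of side t / n. The order t / n <= s <= bulk
  side follows from exp x >= 1 + x and - ln (1 - s^2) >= s^2; the bound on s keeps the logarithm
  meaningful and matches the lattice estimate.\<close>

lemma bulk_side_facts:
  assumes "0 < t" "0 < n" and s: "s = exp (t / real n) - 1" "s \<le> 1 / 10"
  shows "0 < s" "t / real n \<le> s" "t / real n \<le> bulk_side t n" "0 < bulk_side t n"
    "1 - exp (- (bulk_side t n)\<^sup>2) = s\<^sup>2" "1 - exp (- (t / real n)) = s / (1 + s)"
proof -
  have a: "0 < t / real n" using assms by simp
  show le: "t / real n \<le> s" using exp_ge_add_one_self[of "t / real n"] s(1) by linarith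
  then show s0: "0 < s" using a by linarith
  have "s\<^sup>2 \<le> (1 / 10)\<^sup>2" using s0 s by (intro power_mono) auto
  then have s2: "0 < 1 - s\<^sup>2" by (simp add: power2_eq_square)
  have ln: "s\<^sup>2 \<le> - ln (1 - s\<^sup>2)" using ln_le_minus_one[OF s2] by simp
  have b2: "(bulk_side t n)\<^sup>2 = - ln (1 - s\<^sup>2)"
    unfolding bulk_side_def s(1)[symmetric] using ln zero_le_power2[of s] by (intro real_sqrt_pow2) linarith
  have "s \<le> bulk_side t n"
    unfolding bulk_side_def s(1)[symmetric] using ln by (intro real_le_rsqrt)
  then show "t / real n \<le> bulk_side t n" "0 < bulk_side t n" using le s0 by linarith+
  show "1 - exp (- (bulk_side t n)\<^sup>2) = s\<^sup>2" using s2 by (simp add: b2)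
  have "exp (t / real n) = 1 + s" using s by simp
  then show "1 - exp (- (t / real n)) = s / (1 + s)" using s0 by (simp add: exp_minus field_simps)
qed

context
  fixes P :: "'a measure" and alpha :: "'a \<Rightarrow> (real \<times> real) set" and src snk :: "'a \<Rightarrow> real set" and t :: real
  assumes model: "hammersley_model P alpha src snk" and t: "0 < t"
begin

interpretation prob_space P
  using model by (simp add: hammersley_model_def)

abbreviation (input) Z :: "'a \<Rightarrow> real" where "Z \<omega> \<equiv> hZ (alpha \<omega>) (src \<omega>) (snk \<omega>) t"

abbreviation (input) grd :: "nat \<Rightarrow> 'a \<Rightarrow> site \<Rightarrow> bool" where
  "grd n \<omega> \<equiv> grid (t / real n) (bulk_side t n) n (alpha \<omega>) (src \<omega>) (snk \<omega>)"

definition exit_approx :: "nat \<Rightarrow> 'a \<Rightarrow> real" where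
  "exit_approx n \<omega> = real (exit_index (grd n \<omega>) n) * (t / real n)"

lemma exit_approx_bounds: "0 \<le> exit_approx n \<omega>" "exit_approx n \<omega> \<le> t"
proof -
  show "0 \<le> exit_approx n \<omega>" using t by (simp add: exit_approx_def)
  show "exit_approx n \<omega> \<le> t" using exit_index_le[of "grd n \<omega>" n] t by (cases "n = 0") (auto simp: exit_approx_def field_simps)
qed

lemma eventually_good: "\<forall>\<^sub>F n in sequentially. 0 < n \<and> exp (t / real n) - 1 \<le> 1 / 10"
proof -
  have "\<forall>\<^sub>F n in sequentially. exp (t / real n) - 1 < 1 / 10"
    using order_tendstoD(2)[OF step_lim[OF t], of "1 / 10"] by simp
  with eventually_gt_at_top[of 0] show ?thesis by eventually_elim auto
qed

lemma AE_config: "AE \<omega> in P. config (alpha \<omega>) (src \<omega>) (snk \<omega>) t"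
proof -
  have "AE \<omega> in P. (\<forall>B :: (real \<times> real) set. bounded B \<longrightarrow> finite (alpha \<omega> \<inter> B)) \<and>
        (\<forall>B :: real set. bounded B \<longrightarrow> finite (src \<omega> \<inter> B) \<and> finite (snk \<omega> \<inter> B))"
    using model by (simp add: hammersley_model_def)
  then show ?thesis by eventually_elim (use t in \<open>auto simp: config_def\<close>)
qed

lemma eventually_bulk_side_ge: "\<forall>\<^sub>F n in sequentially. t / real n \<le> bulk_side t n"
  using eventually_good by eventually_elim (use bulk_side_facts[OF t] in auto)

lemma AE_exit_approx_le: "AE \<omega> in P. \<forall>\<^sub>F n in sequentially. exit_approx n \<omega> \<le> max (Z \<omega>) 0"
  using AE_config
  by eventually_elim (unfold exit_approx_def, intro config.eventually_exit_index_le eventually_bulk_side_ge bulk_side_lim t)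

lemma AE_exit_approx_ge: "0 \<le> u \<Longrightarrow> AE \<omega> in P. u < Z \<omega> \<longrightarrow> (\<forall>\<^sub>F n in sequentially. u \<le> exit_approx n \<omega>)"
  using AE_config
  by eventually_elim (unfold exit_approx_def, intro impI config.eventually_exit_index_ge eventually_bulk_side_ge bulk_side_lim t)

context
  fixes n :: nat and s :: real
  assumes n: "0 < n" and s: "s = exp (t / real n) - 1" "s \<le> 1 / 10"
begin

lemmas side_facts = bulk_side_facts[OF t n s]

lemma grd_law:
  "grd n \<in> P \<rightarrow>\<^sub>M count_space UNIV"
  "distr P (count_space UNIV) (grd n) = measure_pmf (law n (s / (1 + s)) (s / (1 + s)) (s\<^sup>2))"
proof -
  have "0 < t / real n" using t n by simp
  note * = measurable_grid[OF model this side_facts(4) n] distr_grid[OF model this side_facts(4) n]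
  show "grd n \<in> P \<rightarrow>\<^sub>M count_space UNIV" by (rule *)
  show "distr P (count_space UNIV) (grd n) = measure_pmf (law n (s / (1 + s)) (s / (1 + s)) (s\<^sup>2))"
    using *(2) side_facts(5,6) by simp
qed

lemma measurable_exit_approx: "exit_approx n \<in> borel_measurable P"
  unfolding exit_approx_def by (intro borel_measurable_times measurable_compose[OF grd_law(1)]) auto

lemma integrable_exit_approx: "integrable P (exit_approx n)"
  using exit_approx_bounds[of n] by (intro integrable_const_bound[where B = t] measurable_exit_approx) auto

lemma exit_approx_tail:
  assumes u: "0 < u" "u \<le> t"
  shows "prob {\<omega> \<in> space P. u \<le> exit_approx n \<omega>} \<le> 192 * t\<^sup>2 * (2 / u ^ 3 + 4 * expectation (exit_approx n) / u ^ 4)"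
proof -
  let ?\<mu> = "law n (s / (1 + s)) (s / (1 + s)) (s\<^sup>2)"
  define a where "a = t / real n"
  have a: "0 < a" "a \<le> s" "real n * a = t" using t n side_facts by (auto simp: a_def)
  \<comment> \<open>Rounding up makes the event u <= \<open>exit_approx\<close> imply m <=
    \<open>exit_index\<close>, and also gives u <= m a, which lets u replace m a in the
    denominators.\<close>
  define m where "m = nat \<lceil>u / a\<rceil>"
  have ua: "0 < u / a" "u / a \<le> real n" using u a by (auto simp: pos_divide_le_eq)
  then have m: "1 \<le> m" "m \<le> n" "u / a \<le> real m" unfolding m_def by linarith+
  then have M: "u \<le> real m * a" using a by (simp add: pos_divide_le_eq)
  define e where "e = measure_pmf.expectation ?\<mu> (\<lambda>f. exit_index f n)"
  have e: "expectation (exit_approx n) = e * a"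
  proof -
    have "expectation (\<lambda>\<omega>. real (exit_index (grd n \<omega>) n)) = e"
      unfolding e_def grd_law(2)[symmetric] by (rule integral_distr[symmetric, OF grd_law(1)]) simp
    moreover have "exit_approx n = (\<lambda>\<omega>. real (exit_index (grd n \<omega>) n) * a)" by (simp add: fun_eq_iff exit_approx_def a_def)
    ultimately show ?thesis by simp
  qed
  have e0: "0 \<le> e" by (simp add: e_def)
  have "prob {\<omega> \<in> space P. u \<le> exit_approx n \<omega>} \<le> prob {\<omega> \<in> space P. m \<le> exit_index (grd n \<omega>) n}"
  proof (rule finite_measure_mono)
    show "{\<omega> \<in> space P. u \<le> exit_approx n \<omega>} \<subseteq> {\<omega> \<in> space P. m \<le> exit_index (grd n \<omega>) n}"
    proof clarify
      fix \<omega> assume "u \<le> exit_approx n \<omega>"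
      then have "u / a \<le> real (exit_index (grd n \<omega>) n)" using a by (simp add: exit_approx_def a_def[symmetric] pos_divide_le_eq)
      then show "m \<le> exit_index (grd n \<omega>) n" unfolding m_def by linarith
    qed
    show "{\<omega> \<in> space P. m \<le> exit_index (grd n \<omega>) n} \<in> events"
      using measurable_sets[OF grd_law(1), of "{f. m \<le> exit_index f n}"] by (simp add: vimage_def Int_def conj_commute)
  qed
  also have "\<dots> = measure (distr P (count_space UNIV) (grd n)) {f. m \<le> exit_index f n}"
    by (subst measure_distr[OF grd_law(1)]) (auto intro!: arg_cong[where f = prob])
  also have "\<dots> \<le> 192 * n ^ 2 * (2 * real m + 4 * e) / (s * m ^ 4)"
    unfolding grd_law(2) e_def using m side_facts s by (intro exit_index_tail_discrete) auto
  also have "\<dots> \<le> 192 * n ^ 2 * (2 * real m + 4 * e) / (a * m ^ 4)"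
    using a m e0 by (intro divide_left_mono mult_right_mono) auto
  also have "\<dots> = 192 * (real n * a) ^ 2 * (2 / (real m * a) ^ 3 + 4 * (e * a) / (real m * a) ^ 4)"
    using a(1) m(1) by (simp add: field_simps power2_eq_square power3_eq_cube power4_eq_xxxx)
  also have "\<dots> \<le> 192 * (real n * a) ^ 2 * (2 / u ^ 3 + 4 * (e * a) / u ^ 4)"
    using M u e0 a m by (intro mult_left_mono add_mono divide_left_mono power_mono) auto
  finally show ?thesis unfolding a(3) e .
qed

end

text \<open>One-sided comparisons suffice. The excess of the approximation over the positive part of
  Z vanishes in mean by dominated convergence, which controls the expectation on the right; the part
  of the event u < Z missed by the approximation vanishes in probability.\<close>

lemma exit_tail:
  assumes int: "integrable P (\<lambda>\<omega>. max (Z \<omega>) 0)" and u: "0 < u" "u \<le> t"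
  shows "prob {\<omega> \<in> space P. u < Z \<omega>} \<le> 192 * t\<^sup>2 * (2 / u ^ 3 + 4 * expectation (\<lambda>\<omega>. max (Z \<omega>) 0) / u ^ 4)"
proof -
  let ?Zp = "\<lambda>\<omega>. max (Z \<omega>) 0"
  have Zp [measurable]: "?Zp \<in> borel_measurable P" using int by simp
  \<comment> \<open>Dominated convergence asks for measurability of every member of the sequence, so
    the sequence starts only where the mesh is fine enough.\<close>
  obtain N where N: "\<And>n. N \<le> n \<Longrightarrow> 0 < n \<and> exp (t / real n) - 1 \<le> 1 / 10"
    using eventually_good by (auto simp: eventually_sequentially)
  define z where "z i = exit_approx (i + N)" for i
  have z [measurable]: "z i \<in> borel_measurable P" for i
    unfolding z_def using N[of "i + N"] by (intro measurable_exit_approx[OF _ refl]) auto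
  have zint: "integrable P (z i)" for i
    unfolding z_def using N[of "i + N"] by (intro integrable_exit_approx[OF _ refl]) auto
  have shift: "(\<forall>\<^sub>F n in sequentially. Q (n + N)) \<longleftrightarrow> (\<forall>\<^sub>F n in sequentially. Q n)" for Q
    by (rule eventually_sequentially_seg)
  define \<epsilon> where "\<epsilon> i = expectation (\<lambda>\<omega>. max (z i \<omega> - ?Zp \<omega>) 0)" for i
  have \<epsilon>: "\<epsilon> \<longlonglongrightarrow> 0"
  proof -
    have "(\<lambda>i. expectation (\<lambda>\<omega>. max (z i \<omega> - ?Zp \<omega>) 0)) \<longlonglongrightarrow> expectation (\<lambda>\<omega>. 0)"
    proof (rule integral_dominated_convergence[where w = "\<lambda>_. t"])
      show "AE \<omega> in P. (\<lambda>i. max (z i \<omega> - ?Zp \<omega>) 0) \<longlonglongrightarrow> 0"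
        using AE_exit_approx_le
      proof eventually_elim
        case (elim \<omega>)
        then have "\<forall>\<^sub>F i in sequentially. z i \<omega> \<le> ?Zp \<omega>" unfolding z_def shift[of "\<lambda>n. exit_approx n \<omega> \<le> ?Zp \<omega>"] .
        then have "\<forall>\<^sub>F i in sequentially. max (z i \<omega> - ?Zp \<omega>) 0 = 0" by eventually_elim linarith
        then show ?case by (rule tendsto_eventually)
      qed
      show "AE \<omega> in P. norm (max (z i \<omega> - ?Zp \<omega>) 0) \<le> t" for i
      proof (intro AE_I2)
        fix \<omega> show "norm (max (z i \<omega> - ?Zp \<omega>) 0) \<le> t"
          using exit_approx_bounds[of "i + N" \<omega>] t unfolding z_def by auto
      qed
    qed auto
    moreover have "\<epsilon> = (\<lambda>i. expectation (\<lambda>\<omega>. max (z i \<omega> - ?Zp \<omega>) 0))" by (rule ext) (rule \<epsilon>_def)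
    ultimately show ?thesis by simp
  qed
  have Ez: "expectation (z i) \<le> expectation ?Zp + \<epsilon> i" for i
  proof -
    have d: "integrable P (\<lambda>\<omega>. max (z i \<omega> - ?Zp \<omega>) 0)"
      by (rule integrable_max[OF Bochner_Integration.integrable_diff[OF zint int]]) simp
    have "expectation (z i) \<le> expectation (\<lambda>\<omega>. ?Zp \<omega> + max (z i \<omega> - ?Zp \<omega>) 0)"
      by (rule integral_mono[OF zint Bochner_Integration.integrable_add[OF int d]]) linarith
    also have "\<dots> = expectation ?Zp + \<epsilon> i"
      unfolding \<epsilon>_def by (rule Bochner_Integration.integral_add[OF int d])
    finally show ?thesis .
  qed
  define Q where "Q = {\<omega> \<in> space P. u < Z \<omega>}"
  define B where "B i = {\<omega> \<in> space P. u \<le> z i \<omega>}" for i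
  \<comment> \<open>Measurability is available only for the positive part of Z, through its
    integrability; as u > 0, it determines the event.\<close>
  have "Q = {\<omega> \<in> space P. u < ?Zp \<omega>}" using u by (auto simp: Q_def)
  then have Q [measurable]: "Q \<in> events" by simp
  have B [measurable]: "B i \<in> events" for i unfolding B_def by simp
  have QB: "(\<lambda>i. prob (Q - B i)) \<longlonglongrightarrow> 0"
  proof -
    have "(\<lambda>i. expectation (indicator (Q - B i))) \<longlonglongrightarrow> expectation (\<lambda>\<omega>. 0 :: real)"
    proof (rule integral_dominated_convergence[where w = "\<lambda>_. 1"])
      show "AE \<omega> in P. (\<lambda>i. indicator (Q - B i) \<omega> :: real) \<longlonglongrightarrow> 0"
        using AE_exit_approx_ge[OF less_imp_le[OF u(1)]] AE_space
      proof eventually_elim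
        case (elim \<omega>)
        have "\<forall>\<^sub>F i in sequentially. \<omega> \<in> Q \<longrightarrow> u \<le> z i \<omega>"
        proof (cases "\<omega> \<in> Q")
          case True
          then have "\<forall>\<^sub>F n in sequentially. u \<le> exit_approx n \<omega>" using elim by (auto simp: Q_def)
          then have "\<forall>\<^sub>F i in sequentially. u \<le> z i \<omega>" unfolding z_def shift[of "\<lambda>n. u \<le> exit_approx n \<omega>"] .
          then show ?thesis by eventually_elim simp
        qed simp
        then have "\<forall>\<^sub>F i in sequentially. indicator (Q - B i) \<omega> = (0 :: real)"
          by eventually_elim (use elim(2) in \<open>auto simp: B_def indicator_def\<close>)
        then show ?case by (rule tendsto_eventually)
      qed
    qed (auto simp: indicator_def)
    then show ?thesis by simp
  qed
  define \<beta> where "\<beta> e = 192 * t\<^sup>2 * (2 / u ^ 3 + 4 * (expectation ?Zp + e) / u ^ 4)" for e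
  have PB: "prob (B i) \<le> \<beta> (\<epsilon> i)" for i
  proof -
    have "prob (B i) \<le> 192 * t\<^sup>2 * (2 / u ^ 3 + 4 * expectation (z i) / u ^ 4)"
      unfolding B_def z_def using N[of "i + N"] u by (intro exit_approx_tail[OF _ refl]) auto
    also have "\<dots> \<le> \<beta> (\<epsilon> i)"
      unfolding \<beta>_def using Ez[of i] u by (intro mult_left_mono add_left_mono divide_right_mono) auto
    finally show ?thesis .
  qed
  have "prob Q \<le> \<beta> (\<epsilon> i) + prob (Q - B i)" for i
  proof -
    have "prob Q \<le> prob (B i \<union> (Q - B i))" by (intro finite_measure_mono) auto
    also have "\<dots> \<le> prob (B i) + prob (Q - B i)" by (intro measure_Un_le) auto
    finally show ?thesis using PB[of i] by linarith
  qed
  moreover have "(\<lambda>i. \<beta> (\<epsilon> i) + prob (Q - B i)) \<longlonglongrightarrow> \<beta> 0 + 0"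
    unfolding \<beta>_def by (intro tendsto_intros QB \<epsilon>) (use u in auto)
  ultimately have "prob Q \<le> \<beta> 0" by (intro LIMSEQ_le_const) auto
  then show ?thesis by (simp add: \<beta>_def Q_def)
qed

end

theorem theorem4p2:
  "\<exists>Mc :: real. \<forall>(P :: 'a measure) alpha src snk (t :: real) (c :: real).
     hammersley_model P alpha src snk \<longrightarrow>
     (let Z = (\<lambda>\<omega>. hZ (alpha \<omega>) (src \<omega>) (snk \<omega>) t);
          EZ = (\<integral>\<omega>. max (Z \<omega>) 0 \<partial>P)
      in 0 < t \<longrightarrow> 0 < c \<longrightarrow> c \<le> t / EZ \<longrightarrow>
         measure P {\<omega> \<in> space P. Z \<omega> > c * EZ}
           \<le> Mc * (t ^ 2 / EZ ^ 3) * (1 / c ^ 3 + 1 / c ^ 4))"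
proof (intro exI[of _ 768] allI impI, unfold Let_def, intro impI)
  fix P :: "'a measure" and alpha :: "'a \<Rightarrow> (real \<times> real) set" and src snk :: "'a \<Rightarrow> real set"
    and t c :: real
  let ?Z = "\<lambda>\<omega>. hZ (alpha \<omega>) (src \<omega>) (snk \<omega>) t"
  define E where "E = (\<integral>\<omega>. max (?Z \<omega>) 0 \<partial>P)"
  assume model: "hammersley_model P alpha src snk" and t: "0 < t" and c: "0 < c"
    and le: "c \<le> t / (\<integral>\<omega>. max (?Z \<omega>) 0 \<partial>P)"
  \<comment> \<open>If E were 0, then t / E = 0 would contradict 0 < c <= t / E. A non-integrable
    function has integral 0 by convention, so this also yields integrability.\<close>
  have "E \<noteq> 0" using c le unfolding E_def by auto
  then have int: "integrable P (\<lambda>\<omega>. max (?Z \<omega>) 0)"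
    unfolding E_def using not_integrable_integral_eq by blast
  have E: "0 < E" using \<open>E \<noteq> 0\<close> unfolding E_def by (simp add: order_less_le)
  have u: "0 < c * E" "c * E \<le> t" using c E le unfolding E_def[symmetric] by (auto simp: field_simps)
  have "measure P {\<omega> \<in> space P. c * E < ?Z \<omega>} \<le> 192 * t\<^sup>2 * (2 / (c * E) ^ 3 + 4 * E / (c * E) ^ 4)"
    using exit_tail[OF model t int u] unfolding E_def .
  \<comment> \<open>With u = c E, the part of the variance bound proportional to u gives 1 / c^3 and
    the part proportional to E gives 1 / c^4. The larger coefficient 4 * 192 = 768 then serves for
    both.\<close>
  also have "\<dots> = t ^ 2 / E ^ 3 * (384 / c ^ 3 + 768 / c ^ 4)"
    using c E by (simp add: field_simps power2_eq_square power3_eq_cube power4_eq_xxxx)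
  also have "\<dots> \<le> t ^ 2 / E ^ 3 * (768 / c ^ 3 + 768 / c ^ 4)"
    using c E by (intro mult_left_mono add_right_mono divide_right_mono) auto
  also have "\<dots> = 768 * (t ^ 2 / E ^ 3) * (1 / c ^ 3 + 1 / c ^ 4)"
    using c E by (simp add: field_simps)
  finally show "measure P {\<omega> \<in> space P. c * (\<integral>\<omega>. max (?Z \<omega>) 0 \<partial>P) < ?Z \<omega>}
      \<le> 768 * (t ^ 2 / (\<integral>\<omega>. max (?Z \<omega>) 0 \<partial>P) ^ 3) * (1 / c ^ 3 + 1 / c ^ 4)"
    unfolding E_def .
qed

end
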